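(* Let $m\in\mathbb{N}$ (so $m\ge1$), let $c_0<1$ be real, $c=\{s\in\mathbb{C}:\operatorname{Re}s=c_0\}$, and let $f\in\mathcal{M}^{-1}(L_c)$ with associated function $f^*\in L_1(c)$. Consider $$(Ff)(z)=\frac{(2\pi)^{(1-m)/2}}{m^{1/2}}\int_0^\infty G^{m+1,0}_{0,m+1}\left(\left(\frac{x}{m}\right)^m\,\bigg|\,{-\atop 0,\frac1m,\dots,\frac{m-1}{m},\frac zm}\right)f(x)\,dx .$$ Then the transformation $F$ is well-defined and $(Ff)(z)$ is analytic in the half-plane $\operatorname{Re}z>c_0-1$. Further, for such $z$, $$(Ff)(z)=\frac{1}{2\pi i\,m}\int_{c_0-i\infty}^{c_0+i\infty}\Gamma\left(\frac{1-s+z}{m}\right)\Gamma(1-s)f^*(s)\,ds,$$ and for every real $\gamma>c_0-1$ the operator $F:\mathcal{M}^{-1}(L_c)\to L_1(\gamma-i\infty,\gamma+i\infty)$ is bounded, with norm satisfying $$\|F\|\le\Gamma(1-c_0)\int_{-\infty}^{\infty}\left|\Gamma\left(\frac1m(1-c_0+\gamma+i\tau)\right)\right|d\tau .$$ Moreover, when $c_0-1<\gamma<0$ and $(Ff)(z)\Big/\prod_{k=0}^{m-1}\Gamma\left(\frac{k-z}{m}\right)\in L_1(\gamma-i\infty,\gamma+i\infty)$, then for all $x>0$ the inversion formula $$f(x)=\frac{1}{2\pi i}\int_{\gamma-i\infty}^{\gamma+i\infty}\hat S_m(z,x)(Ff)(z)\,dz,\qquad \hat S_m(z,x)=\sum_{n=0}^\infty\frac{x^{mn-z-1}}{n!\,\Gamma(mn-z)},$$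 holds with the absolutely convergent integral.
   Context: For real $c_0$ let $c=\{s\in\mathbb{C}:\operatorname{Re}s=c_0\}$. $\mathcal{M}^{-1}(L_c)$ denotes the space of functions $f(x)$, $x>0$, representable as $$f(x)=\frac{1}{2\pi i}\int_c f^*(s)x^{-s}\,ds$$ with $f^*\in L_1(c)$ (integrable on the vertical line $c$). It is a Banach space with the norm $\|f\|_{\mathcal{M}^{-1}(L_c)}=\frac{1}{2\pi}\int_{-\infty}^{\infty}|f^*(c_0+it)|\,dt$. The function $f^*$ always denotes the one in this representation of $f$. For real $\gamma$, $L_1(\gamma-i\infty,\gamma+i\infty)$ is the space of functions $g$ on the vertical line $\operatorname{Re}z=\gamma$ with norm $\|g\|_1=\int_{-\infty}^{\infty}|g(\gamma+i\tau)|\,d\tau<\infty$. $\Gamma$ is Euler's gamma-function. The Meijer $G$-function in the kernel is the Mellin-Barnes integral $$G^{m+1,0}_{0,m+1}\left(w\,\bigg|\,{-\atop 0,\frac1m,\dots,\frac{m-1}{m},\frac zm}\right)=\frac{1}{2\pi i}\int_{\mu-i\infty}^{\mu+i\infty}\Gamma\left(s+\frac zm\right)\prod_{k=0}^{m-1}\Gamma\left(s+\frac km\right)w^{-s}\,ds,\quad w>0,$$ with $\mu>\max(0,-\operatorname{Re}z/m)$. Equivalently, the whole kernel is $$\frac{(2\pi)^{(1-m)/2}}{m^{1/2}}\,G^{m+1,0}_{0,m+1}\left(\left(\frac{x}{m}\right)^m\,\bigg|\,{-\atop 0,\frac1m,\dots,\frac{m-1}{m},\frac zm}\right)=\int_0^\infty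 e^{-x/t-t^m}t^{z-1}\,dt,\quad x>0,\ z\in\mathbb{C}.$$ *)

theory Defs
  imports "HOL-Analysis.Analysis"
begin

definition line_L1 :: "real \<Rightarrow> (complex \<Rightarrow> complex) set" where
  "line_L1 a = {g. integrable lebesgue (\<lambda>t. g (Complex a t))}"

definition line_norm :: "real \<Rightarrow> (complex \<Rightarrow> complex) \<Rightarrow> real" where
  "line_norm a g = (LINT t|lebesgue. norm (g (Complex a t)))"

text \<open>The contour integral of \<open>g\<close> along the line \<open>Re s = a\<close>, traversed upwards, so that
  \<open>ds = \<i> dt\<close>; meaningful when \<open>g \<in> line_L1 a\<close>.\<close>

definition line_integral :: "real \<Rightarrow> (complex \<Rightarrow> complex) \<Rightarrow> complex" where
  "line_integral a g = \<i> * (LINT t|lebesgue. g (Complex a t))"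

text \<open>\<open>mellin_rep c0 f fs\<close>: the function \<open>fs\<close> plays the role of \<open>f\<^sup>*\<close>. Functions on
  the positive half-line are total functions whose values at \<open>x \<le> 0\<close> are ignored.\<close>

definition mellin_rep :: "real \<Rightarrow> (real \<Rightarrow> complex) \<Rightarrow> (complex \<Rightarrow> complex) \<Rightarrow> bool" where
  "mellin_rep c0 f fs \<longleftrightarrow> fs \<in> line_L1 c0 \<and>
     (\<forall>x>0. f x = 1 / (2 * of_real pi * \<i>) *
        line_integral c0 (\<lambda>s. fs s * of_real x powr (- s)))"

definition inv_mellin_space :: "real \<Rightarrow> (real \<Rightarrow> complex) set" where
  "inv_mellin_space c0 = {f. \<exists>fs. mellin_rep c0 f fs}"

text \<open>The representing function is unique up to a null set of the line, so the choice
  does not affect the norm.\<close>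

definition inv_mellin_norm :: "real \<Rightarrow> (real \<Rightarrow> complex) \<Rightarrow> real" where
  "inv_mellin_norm c0 f = 1 / (2 * pi) * line_norm c0 (SOME fs. mellin_rep c0 f fs)"

definition bounded_operator ::
    "real \<Rightarrow> real \<Rightarrow> ((real \<Rightarrow> complex) \<Rightarrow> complex \<Rightarrow> complex) \<Rightarrow> bool" where
  "bounded_operator c0 \<gamma> T \<longleftrightarrow>
     (\<forall>f\<in>inv_mellin_space c0. T f \<in> line_L1 \<gamma>) \<and>
     (\<forall>f\<in>inv_mellin_space c0. \<forall>g\<in>inv_mellin_space c0. \<forall>a b z. Re z = \<gamma> \<longrightarrow>
        T (\<lambda>x. a * f x + b * g x) z = a * T f z + b * T g z) \<and>
     (\<exists>K. \<forall>f\<in>inv_mellin_space c0. line_norm \<gamma> (T f) \<le> K * inv_mellin_norm c0 f)"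

definition operator_norm ::
    "real \<Rightarrow> real \<Rightarrow> ((real \<Rightarrow> complex) \<Rightarrow> complex \<Rightarrow> complex) \<Rightarrow> real" where
  "operator_norm c0 \<gamma> T =
     Inf {K. 0 \<le> K \<and> (\<forall>f\<in>inv_mellin_space c0. line_norm \<gamma> (T f) \<le> K * inv_mellin_norm c0 f)}"

text \<open>The function \<open>G\<close> with upper indices \<open>m+1, 0\<close>, lower indices \<open>0, m+1\<close> and
  parameters \<open>0, 1/m, \<dots>, (m-1)/m, z/m\<close>, as a Mellin-Barnes integral. The abscissa \<open>\<mu>\<close> of
  the contour is an explicit argument; admissible values are those with \<open>\<mu> > max 0 (- Re z / m)\<close>.\<close>

definition meijer_integrand :: "nat \<Rightarrow> complex \<Rightarrow> real \<Rightarrow> complex \<Rightarrow> complex" where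
  "meijer_integrand m z w s =
     Gamma (s + z / of_nat m) * (\<Prod>k<m. Gamma (s + of_nat k / of_nat m)) * of_real w powr (- s)"

definition meijer_G :: "real \<Rightarrow> nat \<Rightarrow> complex \<Rightarrow> real \<Rightarrow> complex" where
  "meijer_G \<mu> m z w = 1 / (2 * of_real pi * \<i>) * line_integral \<mu> (meijer_integrand m z w)"

text \<open>The abscissa of the contour may be chosen differently for each \<open>z\<close>.\<close>

definition index_transform ::
    "(complex \<Rightarrow> real) \<Rightarrow> nat \<Rightarrow> (real \<Rightarrow> complex) \<Rightarrow> complex \<Rightarrow> complex" where
  "index_transform \<mu> m f z =
     of_real ((2 * pi) powr ((1 - real m) / 2) / sqrt (real m)) *
     (LINT x:{0<..}|lebesgue. meijer_G (\<mu> z) m z ((x / real m) ^ m) * f x)"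

definition S_hat :: "nat \<Rightarrow> complex \<Rightarrow> real \<Rightarrow> complex" where
  "S_hat m z x =
     (\<Sum>n. of_real x powr (of_nat (m * n) - z - 1) / (fact n * Gamma (of_nat (m * n) - z)))"

end

theory Submission
  imports Defs
    "HOL-Probability.Characteristic_Functions"
    "HOL-Probability.Sinc_Integral"
    "HOL-Complex_Analysis.Conformal_Mappings"
    "HOL-Computational_Algebra.Polynomial"
begin

text \<open>
  All integrals over the half-line are moved to the real line by the substitution \<open>x = exp u\<close>.
  There powers become exponentials, Mellin transforms become Fourier transforms, and every double
  integral below is dominated by a function \<open>a x * b (y - \<kappa> x)\<close> with \<open>a\<close> and \<open>b\<close> integrable
  and \<open>\<kappa>\<close> equal to 0 or 1, which justifies each interchange of integrals.

  Gauss' multiplication formula turns the product of gamma factors in the Mellin-Barnes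
  integral into a single factor \<open>\<Gamma>(m s)\<close>, and the Cahen-Mellin formula, which is Fourier inversion for
  \<open>exp (\<sigma> u - exp u)\<close>, then identifies the normalised \<open>G\<close>-kernel with
  \<open>\<integral> exp (- x / t - t ^ m) t powr (z - 1) dt\<close> (\<open>mellin_barnes_kernel\<close>). The Mellin transform of
  that kernel in \<open>x\<close> is \<open>\<Gamma>(1 - s) \<Gamma>((1 - s + z) / m) / m\<close>, so integrating the kernel against
  \<open>f\<close>, written as a superposition of the powers \<open>x powr (- s)\<close>, gives the representation of \<open>F f\<close>
  as a contour integral (\<open>index_transform_eq_gamma_transform\<close>). Analyticity and the norm bound
  are read off from it, since \<open>|\<Gamma>(s)| \<le> \<Gamma>(Re s)\<close> on the right half-plane and \<open>\<Gamma>\<close> is integrable on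
  vertical lines there.

  For the inversion, let \<open>L\<close> be the Laplace transform. Applying the Cahen-Mellin formula in
  the variable \<open>z\<close> to the contour integral for \<open>F f\<close> gives, for \<open>p > 0\<close>,
  \<open>2 \<pi> \<i> (L f)(p) = \<integral> (F f)(z) p powr z * exp (p powr (- m)) dz\<close>. Term by term integration shows that
  \<open>p powr z * exp (p powr (- m))\<close> is the Laplace transform of \<open>S_hat m z\<close>; the series converges absolutely
  because \<open>1 / |\<Gamma>(m n - z)|\<close> is at most \<open>\<Gamma>(- Re z) / |\<Gamma>(- z)|\<close> times \<open>1 / \<Gamma>(m n - Re z)\<close>, which
  is bounded in \<open>n\<close>. The same bound shows that integrability of \<open>(F f)(z) / \<Gamma>(- z)\<close>, which is the hypothesis of the
  inversion formula after another use of Gauss' formula, makes both integrals interchangeable. So \<open>f\<close>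
  and the right-hand side of the inversion formula are continuous functions with the same Laplace
  transform, and they coincide (\<open>laplace_unique\<close>).
\<close>

section \<open>Dominated double integrals and parametric integrals\<close>

lemma sheared_product:
  fixes a b :: "real \<Rightarrow> real"
  assumes a: "integrable lborel a" and b: "integrable lborel b"
  shows "integrable (lborel \<Otimes>\<^sub>M lborel) (\<lambda>(x, y). a x * b (y - \<kappa> * x))"
    and "(\<integral>y. \<integral>x. a x * b (y - \<kappa> * x) \<partial>lborel \<partial>lborel) = (\<integral>x. a x \<partial>lborel) * (\<integral>y. b y \<partial>lborel)"
proof -
  have [measurable]: "a \<in> borel_measurable borel" "b \<in> borel_measurable borel"
    using a b by (simp_all add: borel_measurable_integrable)
  have shift: "integrable lborel (\<lambda>y. b (y - c))" "(\<integral>y. b (y - c) \<partial>lborel) = (\<integral>y. b y \<partial>lborel)"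
      "(\<integral>y. \<bar>b (y - c)\<bar> \<partial>lborel) = (\<integral>y. \<bar>b y\<bar> \<partial>lborel)" for c
    using lborel_integrable_real_affine[OF b, of 1 "- c"] lborel_integral_real_affine[of 1 b "- c"]
      lborel_integral_real_affine[of 1 "\<lambda>y. \<bar>b y\<bar>" "- c"] by simp_all
  show int: "integrable (lborel \<Otimes>\<^sub>M lborel) (\<lambda>(x, y). a x * b (y - \<kappa> * x))"
  proof (rule lborel_pair.Fubini_integrable)
    show "integrable lborel (\<lambda>x. \<integral>y. norm (case (x, y) of (x, y) \<Rightarrow> a x * b (y - \<kappa> * x)) \<partial>lborel)"
      using a shift(3) by (simp add: abs_mult)
    show "AE x in lborel. integrable lborel (\<lambda>y. case (x, y) of (x, y) \<Rightarrow> a x * b (y - \<kappa> * x))"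
      using shift(1) by simp
  qed measurable
  show "(\<integral>y. \<integral>x. a x * b (y - \<kappa> * x) \<partial>lborel \<partial>lborel) = (\<integral>x. a x \<partial>lborel) * (\<integral>y. b y \<partial>lborel)"
    using lborel_pair.Fubini_integral[OF int] shift(2) by simp
qed

text \<open>
  The criterion behind every use of Fubini's theorem below. The shear allows for majorants
  such as \<open>exp (u - v - exp (u - v)) * g v\<close>, which become products only after a translation
  depending on the other variable.
\<close>

lemma integrable_pair_sheared_product:
  fixes F :: "real \<Rightarrow> real \<Rightarrow> complex" and a b :: "real \<Rightarrow> real"
  assumes F: "case_prod F \<in> borel_measurable (lborel \<Otimes>\<^sub>M lborel)"
    and a: "integrable lborel a" and b: "integrable lborel b"
    and bound: "\<And>x y. norm (F x y) \<le> a x * b (y - \<kappa> * x)"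
  shows "integrable (lborel \<Otimes>\<^sub>M lborel) (case_prod F)"
  using sheared_product(1)[OF a b, of \<kappa>] F
  by (rule Bochner_Integration.integrable_bound)
     (use bound in \<open>auto intro!: AE_I2 order.trans[OF bound]\<close>)

text \<open>
  Young's inequality \<open>\<parallel>a \<star> b\<parallel> \<le> \<parallel>a\<parallel> \<parallel>b\<parallel>\<close> in \<open>L\<^sup>1\<close>, for \<open>\<kappa> = 1\<close>; it is the source of the bound
  for the operator norm.
\<close>

lemma norm_integral_sheared_product_le:
  fixes F :: "real \<Rightarrow> real \<Rightarrow> complex" and a b :: "real \<Rightarrow> real"
  assumes F [measurable]: "case_prod F \<in> borel_measurable (lborel \<Otimes>\<^sub>M lborel)"
    and a: "integrable lborel a" and b: "integrable lborel b"
    and bound: "\<And>x y. norm (F x y) \<le> a x * b (y - \<kappa> * x)"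
  shows "(\<integral>y. norm (\<integral>x. F x y \<partial>lborel) \<partial>lborel) \<le> (\<integral>x. a x \<partial>lborel) * (\<integral>y. b y \<partial>lborel)"
proof -
  note prod = sheared_product[OF a b, of \<kappa>]
  note F_int = integrable_pair_sheared_product[OF F a b bound]
  have "(\<integral>y. norm (\<integral>x. F x y \<partial>lborel) \<partial>lborel) \<le> (\<integral>y. \<integral>x. a x * b (y - \<kappa> * x) \<partial>lborel \<partial>lborel)"
  proof (rule integral_mono_AE)
    show "integrable lborel (\<lambda>y. norm (\<integral>x. F x y \<partial>lborel))"
      using lborel_pair.integrable_snd[OF F_int] by simp
    show "integrable lborel (\<lambda>y. \<integral>x. a x * b (y - \<kappa> * x) \<partial>lborel)"
      using lborel_pair.integrable_snd[OF prod(1)] by simp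
    have "AE y in lborel. integrable lborel (\<lambda>x. F x y)" "AE y in lborel. integrable lborel (\<lambda>x. a x * b (y - \<kappa> * x))"
      using lborel_pair.AE_integrable_snd[OF F_int] lborel_pair.AE_integrable_snd[OF prod(1)] by simp_all
    then show "AE y in lborel. norm (\<integral>x. F x y \<partial>lborel) \<le> (\<integral>x. a x * b (y - \<kappa> * x) \<partial>lborel)"
    proof eventually_elim
      case (elim y)
      have "norm (\<integral>x. F x y \<partial>lborel) \<le> (\<integral>x. norm (F x y) \<partial>lborel)" by (rule integral_norm_bound)
      also have "\<dots> \<le> (\<integral>x. a x * b (y - \<kappa> * x) \<partial>lborel)"
        using elim bound by (intro integral_mono integrable_norm)
      finally show ?case .
    qed
  qed
  then show ?thesis unfolding prod(2) .
qed

text \<open>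
  A majorant that is locally bounded in the parameter suffices, since continuity can be tested
  on convergent sequences.
\<close>

lemma isCont_parametric_integral:
  fixes F :: "'a \<Rightarrow> real \<Rightarrow> complex"
  assumes meas: "\<And>u. (\<lambda>t. F t u) \<in> borel_measurable M"
    and cont: "\<And>t. isCont (F t) u0"
    and bound: "\<And>t u. norm (F t u) \<le> norm (w t) * g u"
    and w: "integrable M (w :: 'a \<Rightarrow> complex)" and g: "isCont g u0"
  shows "isCont (\<lambda>u. \<integral>t. F t u \<partial>M) u0"
proof (rule continuous_at_sequentiallyI)
  fix x :: "nat \<Rightarrow> real" assume x: "x \<longlonglongrightarrow> u0"
  have "(\<lambda>n. g (x n)) \<longlonglongrightarrow> g u0" using isCont_tendsto_compose[OF g x] .
  then have "Bseq (\<lambda>n. g (x n))" by (intro convergent_imp_Bseq convergentI)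
  then obtain K where K: "\<And>n. norm (g (x n)) \<le> K" by (auto simp: Bseq_def)
  show "(\<lambda>n. \<integral>t. F t (x n) \<partial>M) \<longlonglongrightarrow> (\<integral>t. F t u0 \<partial>M)"
  proof (rule integral_dominated_convergence[where w="\<lambda>t. norm (w t) * K"])
    show "AE t in M. (\<lambda>n. F t (x n)) \<longlonglongrightarrow> F t u0"
      using isCont_tendsto_compose[OF cont x] by simp
    show "AE t in M. norm (F t (x n)) \<le> norm (w t) * K" for n
    proof (rule AE_I2)
      fix t
      have "norm (F t (x n)) \<le> norm (w t) * g (x n)" by (rule bound)
      also have "\<dots> \<le> norm (w t) * K" using K[of n] by (intro mult_left_mono) auto
      finally show "norm (F t (x n)) \<le> norm (w t) * K" .
    qed
  qed (use meas w in auto)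
qed

text \<open>
  Cauchy's inequality bounds the derivatives, hence the difference quotients, by a multiple of
  the majorant on a smaller disc, so that dominated convergence applies to the difference
  quotients.
\<close>

lemma holomorphic_on_parametric_integral:
  fixes \<phi> :: "'a \<Rightarrow> complex \<Rightarrow> complex"
  assumes S: "open S"
    and holo: "\<And>t. \<phi> t holomorphic_on S"
    and meas: "\<And>z. z \<in> S \<Longrightarrow> (\<lambda>t. \<phi> t z) \<in> borel_measurable M"
    and B: "integrable M B"
    and bound: "\<And>t z. z \<in> S \<Longrightarrow> norm (\<phi> t z) \<le> B t"
  shows "(\<lambda>z. \<integral>t. \<phi> t z \<partial>M) holomorphic_on S"
proof -
  have int: "integrable M (\<lambda>t. \<phi> t z)" if "z \<in> S" for z
    by (rule Bochner_Integration.integrable_bound[OF B meas[OF that]])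
       (use bound[OF that] in \<open>auto intro!: AE_I2 order.trans[OF bound[OF that]]\<close>)
  have "\<exists>D. ((\<lambda>z. \<integral>t. \<phi> t z \<partial>M) has_field_derivative D) (at z)" if z: "z \<in> S" for z
  proof -
    obtain r0 where r0: "r0 > 0" "cball z r0 \<subseteq> S" using S z open_contains_cball by blast
    \<comment> \<open>Half the radius leaves room for discs of radius \<open>r\<close> around all points of \<open>cball z r\<close>.\<close>
    define r where "r = r0 / 2"
    have r: "r > 0" "cball z (2 * r) \<subseteq> S" using r0 by (auto simp: r_def)
    have sub: "cball w r \<subseteq> S" if "w \<in> cball z r" for w
    proof -
      have "cball w r \<subseteq> cball z (2 * r)" using that by (simp add: cball_subset_cball_iff dist_commute)
      then show ?thesis using r by blast
    qed
    have deriv_bound: "norm (deriv (\<phi> t) w) \<le> B t / r" if w: "w \<in> cball z r" for t w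
    proof -
      have "norm ((deriv ^^ 1) (\<phi> t) w) \<le> fact 1 * B t / r ^ 1"
      proof (rule Cauchy_inequality)
        show "\<phi> t holomorphic_on ball w r"
          using holo sub[OF w] ball_subset_cball holomorphic_on_subset by blast
        show "continuous_on (cball w r) (\<phi> t)"
          using holo sub[OF w] holomorphic_on_imp_continuous_on continuous_on_subset by blast
        show "norm (\<phi> t x) \<le> B t" if "norm (w - x) = r" for x
          using that sub[OF w] by (intro bound) (auto simp: dist_norm subset_iff)
      qed (rule r(1))
      then show ?thesis by simp
    qed
    have quot_bound: "norm ((\<phi> t w - \<phi> t z) / (w - z)) \<le> B t / r" if w: "w \<in> cball z r" "w \<noteq> z" for t w
    proof -
      have "norm (\<phi> t w - \<phi> t z) \<le> B t / r * norm (w - z)"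
      proof (rule field_differentiable_bound)
        show "convex (cball z r)" by simp
        show "(\<phi> t has_field_derivative deriv (\<phi> t) x) (at x within cball z r)" if "x \<in> cball z r" for x
        proof -
          have "x \<in> S" using sub[OF that] r(1) by auto
          then show ?thesis using holo S holomorphic_derivI[of "\<phi> t" S x] by blast
        qed
      qed (use w r deriv_bound in auto)
      then show ?thesis using w(2) by (simp add: norm_divide divide_le_eq)
    qed
    have "((\<lambda>w. ((\<integral>t. \<phi> t w \<partial>M) - (\<integral>t. \<phi> t z \<partial>M)) / (w - z)) \<longlongrightarrow> (\<integral>t. deriv (\<phi> t) z \<partial>M)) (at z)"
      unfolding tendsto_at_iff_sequentially
    proof (intro allI impI)
      fix X :: "nat \<Rightarrow> complex" assume X: "\<forall>i. X i \<in> UNIV - {z}" "X \<longlonglongrightarrow> z"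
      have "eventually (\<lambda>n. X n \<in> ball z r) sequentially"
        using X(2) r(1) by (intro topological_tendstoD) auto
      then obtain N where N: "\<And>n. n \<ge> N \<Longrightarrow> X n \<in> ball z r" by (auto simp: eventually_sequentially)
      \<comment> \<open>A tail of the sequence lies in the disc where the difference quotients are dominated.\<close>
      define Y where "Y = (\<lambda>n. X (n + N))"
      have Y: "Y n \<in> cball z r" "Y n \<in> S" "Y n \<noteq> z" for n
        using N[of "n + N"] X(1) sub[of z] r(1) by (auto simp: Y_def intro!: less_imp_le)
      have Ylim: "Y \<longlonglongrightarrow> z" unfolding Y_def using X(2) by (rule LIMSEQ_ignore_initial_segment)
      have quot_lim: "(\<lambda>n. (\<phi> t (Y n) - \<phi> t z) / (Y n - z)) \<longlonglongrightarrow> deriv (\<phi> t) z" for t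
      proof -
        have "(\<phi> t has_field_derivative deriv (\<phi> t) z) (at z)"
          using holo S z holomorphic_derivI by blast
        then have "((\<lambda>w. (\<phi> t w - \<phi> t z) / (w - z)) \<longlongrightarrow> deriv (\<phi> t) z) (at z)"
          by (simp add: has_field_derivative_iff)
        then show ?thesis unfolding tendsto_at_iff_sequentially using Y Ylim by (auto simp: o_def)
      qed
      have quot_meas: "(\<lambda>t. (\<phi> t (Y n) - \<phi> t z) / (Y n - z)) \<in> borel_measurable M" for n
        using meas[OF z] meas[OF Y(2)] by measurable
      have "(\<lambda>n. \<integral>t. (\<phi> t (Y n) - \<phi> t z) / (Y n - z) \<partial>M) \<longlonglongrightarrow> (\<integral>t. deriv (\<phi> t) z \<partial>M)"
      proof (rule integral_dominated_convergence[where w="\<lambda>t. B t / r"])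
        show "(\<lambda>t. deriv (\<phi> t) z) \<in> borel_measurable M"
          using quot_meas quot_lim by (rule borel_measurable_LIMSEQ_metric)
      qed (use quot_meas quot_lim quot_bound Y B in auto)
      moreover have "(\<integral>t. (\<phi> t (Y n) - \<phi> t z) / (Y n - z) \<partial>M) = ((\<integral>t. \<phi> t (Y n) \<partial>M) - (\<integral>t. \<phi> t z \<partial>M)) / (Y n - z)" for n
        using int[OF z] int[OF Y(2)] by (simp add: Bochner_Integration.integral_diff)
      ultimately have "(\<lambda>n. ((\<integral>t. \<phi> t (X (n + N)) \<partial>M) - (\<integral>t. \<phi> t z \<partial>M)) / (X (n + N) - z)) \<longlonglongrightarrow> (\<integral>t. deriv (\<phi> t) z \<partial>M)"
        by (simp only: Y_def)
      then show "((\<lambda>w. ((\<integral>t. \<phi> t w \<partial>M) - (\<integral>t. \<phi> t z \<partial>M)) / (w - z)) \<circ> X) \<longlonglongrightarrow> (\<integral>t. deriv (\<phi> t) z \<partial>M)"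
        unfolding o_def by (rule LIMSEQ_offset)
    qed
    then show ?thesis by (auto simp: has_field_derivative_iff)
  qed
  then show ?thesis using S by (simp add: holomorphic_on_open)
qed

lemma integrable_lborel_imp_lebesgue:
  fixes g :: "real \<Rightarrow> complex"
  assumes "integrable lborel g"
  shows "integrable lebesgue g" "(\<integral>x. g x \<partial>lebesgue) = (\<integral>x. g x \<partial>lborel)"
  using assms integrable_completion[of g lborel] integral_completion[of g lborel]
  by (simp_all add: borel_measurable_integrable)

lemma integrable_lebesgue_imp_lborel:
  fixes g :: "real \<Rightarrow> complex"
  assumes "g \<in> borel_measurable borel" "integrable lebesgue g"
  shows "integrable lborel g" 
  using assms integrable_completion[of g lborel] by simp

text \<open>
  Functions on the line that are only Lebesgue measurable are replaced by Borel measurable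
  ones, for which the product measurability needed in Fubini's theorem is available.
\<close>

lemma integrable_lebesgue_AE_lborel:
  fixes g :: "real \<Rightarrow> complex"
  assumes g: "integrable lebesgue g"
  obtains \<phi> where "integrable lborel \<phi>" "AE t in lebesgue. g t = \<phi> t"
proof -
  have g_meas: "g \<in> borel_measurable (completion lborel)" using g by (rule borel_measurable_integrable)
  then have "(\<lambda>t. Re (g t)) \<in> borel_measurable (completion lborel)" "(\<lambda>t. Im (g t)) \<in> borel_measurable (completion lborel)"
    by simp_all
  then obtain a b where [measurable]: "a \<in> borel_measurable lborel" "b \<in> borel_measurable lborel"
    and "AE t in lborel. Re (g t) = a t" "AE t in lborel. Im (g t) = b t"
    using completion_ex_borel_measurable_real[of "\<lambda>t. Re (g t)" lborel]
      completion_ex_borel_measurable_real[of "\<lambda>t. Im (g t)" lborel] by blast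
  then have AE: "AE t in lborel. g t = Complex (a t) (b t)" 
    by (auto simp: complex_eq_iff elim: AE_mp)
  have \<phi>_meas: "(\<lambda>t. Complex (a t) (b t)) \<in> borel_measurable borel"
    unfolding Complex_eq by simp
  have AE': "AE t in lebesgue. g t = Complex (a t) (b t)" using AE by (rule AE_completion)
  have "integrable lebesgue (\<lambda>t. Complex (a t) (b t))"
    using g AE' \<phi>_meas by (subst integrable_cong_AE[of _ _ g]) (auto intro!: measurable_completion)
  then have "integrable lborel (\<lambda>t. Complex (a t) (b t))"
    by (rule integrable_lebesgue_imp_lborel[OF \<phi>_meas])
  with AE' that show ?thesis by blast
qed

section \<open>Fourier inversion\<close>

lemma gaussian_fourier:
  assumes "n > 0"
  shows "(\<integral>t. std_normal_density (t / n) *\<^sub>R iexp (t * u) \<partial>lborel) = n * exp (- (n * u)\<^sup>2 / 2)"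
    and "integrable lborel (\<lambda>t. std_normal_density (t / n))"
proof -
  have "(\<integral>t. std_normal_density t *\<^sub>R iexp (t * (n * u)) \<partial>lborel) = char std_normal_distribution (n * u)"
    unfolding char_def by (subst integral_density) (auto simp: mult.commute)
  also have "\<dots> = exp (- (n * u)\<^sup>2 / 2)" by (simp add: char_std_normal_distribution)
  finally show "(\<integral>t. std_normal_density (t / n) *\<^sub>R iexp (t * u) \<partial>lborel) = n * exp (- (n * u)\<^sup>2 / 2)"
    using assms
    by (subst lborel_integral_real_affine[of n _ 0]) (auto simp: mult_ac scaleR_conv_of_real)
  show "integrable lborel (\<lambda>t. std_normal_density (t / n))"
    using lborel_integrable_real_affine[of std_normal_density "1/n" 0] assms by simp
qed

text \<open>
  The function need not be bounded, so dominated convergence alone does not apply. Near the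
  origin continuity supplies a bound; away from it the Gaussian kernel tends to 0 uniformly,
  and integrability of \<open>h\<close> is enough.
\<close>

lemma gaussian_smoothing_tendsto:
  fixes h :: "real \<Rightarrow> complex"
  assumes h: "integrable lborel h" and cont: "isCont h 0"
  shows "(\<lambda>n. \<integral>u. (real (Suc n) * exp (- (real (Suc n) * u)\<^sup>2 / 2)) *\<^sub>R h u \<partial>lborel) \<longlonglongrightarrow> sqrt (2 * pi) * h 0"
proof -
  have [measurable]: "h \<in> borel_measurable borel" using h by (simp add: borel_measurable_integrable)
  from cont obtain \<delta> where \<delta>: "\<delta> > 0" "\<And>u. \<bar>u\<bar> < \<delta> \<Longrightarrow> dist (h u) (h 0) < 1"
    unfolding continuous_at_eps_delta by (metis dist_0_norm dist_commute real_norm_def zero_less_one)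
  define B where "B = norm (h 0) + 1"
  have B: "norm (h u) \<le> B" if "\<bar>u\<bar> < \<delta>" for u
    using \<delta>(2)[OF that] unfolding B_def dist_norm
    by (smt (verit) norm_triangle_sub)
  \<comment> \<open>The part near the origin is bounded by \<open>B\<close>, the other one is integrable and vanishes on
    \<open>\<bar>u\<bar> < \<delta>\<close>.\<close>
  define near where "near = (\<lambda>u. indicator {-\<delta><..<\<delta>} u *\<^sub>R h u)"
  define far where "far = (\<lambda>u. indicator (- {-\<delta><..<\<delta>}) u *\<^sub>R h u)"
  have near_meas [measurable]: "near \<in> borel_measurable borel" by (simp add: near_def)
  have far_int: "integrable lborel far" unfolding far_def
    by (intro integrable_mult_indicator h) auto
  have near_int: "integrable lborel near" unfolding near_def
    by (intro integrable_mult_indicator h) auto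
  have near_bound: "norm (near u) \<le> B" for u
    using B[of u] by (auto simp: near_def indicator_def B_def)
  let ?k = "\<lambda>n u. real (Suc n) * exp (- (real (Suc n) * u)\<^sup>2 / 2)"
  have k_bound: "?k n u \<le> real (Suc n)" for n u
    by (simp add: mult_left_le)
  have k_int: "integrable lborel (\<lambda>u. ?k n u *\<^sub>R g u)" if "integrable lborel g" for g :: "real \<Rightarrow> complex" and n
  proof (rule Bochner_Integration.integrable_bound[of _ "\<lambda>u. real (Suc n) *\<^sub>R g u"])
    have [measurable]: "g \<in> borel_measurable borel" using that by (simp add: borel_measurable_integrable)
    show "(\<lambda>u. ?k n u *\<^sub>R g u) \<in> borel_measurable lborel" by simp
    show "AE u in lborel. norm (?k n u *\<^sub>R g u) \<le> norm (real (Suc n) *\<^sub>R g u)"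
      by (intro AE_I2) (auto simp: abs_mult intro!: mult_left_le_one_le)
  qed (use that in simp)
  have near_lim: "(\<lambda>n. \<integral>u. ?k n u *\<^sub>R near u \<partial>lborel) \<longlonglongrightarrow> sqrt (2 * pi) * h 0"
  proof -
    have eq: "(\<integral>u. ?k n u *\<^sub>R near u \<partial>lborel) = (\<integral>v. exp (- v\<^sup>2 / 2) *\<^sub>R near (v / real (Suc n)) \<partial>lborel)" for n
      by (subst (2) lborel_integral_real_affine[of "real (Suc n)" _ 0])
         (simp_all add: integral_scaleR_right[symmetric] del: of_nat_Suc integral_scaleR_right)
    have gauss: "integrable lborel (\<lambda>v::real. exp (- v\<^sup>2 / 2))" "(\<integral>v. exp (- v\<^sup>2 / 2) \<partial>lborel) = sqrt (2 * pi)"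
    proof -
      have "has_bochner_integral lborel std_normal_density 1"
        by (simp add: has_bochner_integral_iff)
      from has_bochner_integral_mult_right[OF this, of "sqrt (2 * pi)"]
      have "has_bochner_integral lborel (\<lambda>v::real. exp (- v\<^sup>2 / 2)) (sqrt (2 * pi))"
        by (simp add: normal_density_def)
      then show "integrable lborel (\<lambda>v::real. exp (- v\<^sup>2 / 2))" "(\<integral>v. exp (- v\<^sup>2 / 2) \<partial>lborel) = sqrt (2 * pi)"
        by (simp_all add: has_bochner_integral_iff)
    qed
    have "(\<lambda>n. \<integral>v. exp (- v\<^sup>2 / 2) *\<^sub>R near (v / real (Suc n)) \<partial>lborel) \<longlonglongrightarrow> (\<integral>v. exp (- v\<^sup>2 / 2) *\<^sub>R h 0 \<partial>lborel)"
    proof (rule integral_dominated_convergence[where w="\<lambda>v. exp (- v\<^sup>2 / 2) * B"])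
      show "integrable lborel (\<lambda>v. exp (- v\<^sup>2 / 2) * B)" using gauss(1) by simp
      show "AE v in lborel. norm (exp (- v\<^sup>2 / 2) *\<^sub>R near (v / real (Suc n))) \<le> exp (- v\<^sup>2 / 2) * B" for n
        using near_bound by simp
      show "AE v in lborel. (\<lambda>n. exp (- v\<^sup>2 / 2) *\<^sub>R near (v / real (Suc n))) \<longlonglongrightarrow> exp (- v\<^sup>2 / 2) *\<^sub>R h 0"
      proof (intro AE_I2 tendsto_intros)
        fix v :: real
        have z: "(\<lambda>n. v / real (Suc n)) \<longlonglongrightarrow> 0" by real_asymp
        have "isCont near 0"
        proof -
          have "eventually (\<lambda>u. u \<in> {-\<delta><..<\<delta>}) (nhds 0)"
            using \<delta>(1) by (intro eventually_nhds_in_open) auto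
          then have "eventually (\<lambda>u. near u = h u) (nhds 0)"
            by eventually_elim (simp add: near_def)
          then show ?thesis using cont isCont_cong by blast
        qed
        then have "(\<lambda>n. near (v / real (Suc n))) \<longlonglongrightarrow> near 0"
          using isCont_tendsto_compose z by blast
        then show "(\<lambda>n. near (v / real (Suc n))) \<longlonglongrightarrow> h 0" using \<delta>(1) by (simp add: near_def)
      qed
    qed simp_all
    also have "(\<integral>v. exp (- v\<^sup>2 / 2) *\<^sub>R h 0 \<partial>lborel) = sqrt (2 * pi) * h 0"
      using gauss by (simp add: scaleR_conv_of_real)
    finally show ?thesis unfolding eq .
  qed
  have far_lim: "(\<lambda>n. \<integral>u. ?k n u *\<^sub>R far u \<partial>lborel) \<longlonglongrightarrow> 0"
  proof (rule tendsto_norm_zero_cancel, rule real_tendsto_sandwich[OF _ _ tendsto_const])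
    show "eventually (\<lambda>n. norm (\<integral>u. ?k n u *\<^sub>R far u \<partial>lborel) \<le> ?k n \<delta> * (\<integral>u. norm (far u) \<partial>lborel)) sequentially"
    proof (intro always_eventually allI)
      fix n
      have "norm (?k n u *\<^sub>R far u) \<le> ?k n \<delta> * norm (far u)" for u
      proof (cases "\<bar>u\<bar> < \<delta>")
        case True then show ?thesis by (auto simp: far_def indicator_def)
      next
        case False
        then have "\<delta>\<^sup>2 \<le> u\<^sup>2" using \<delta>(1) by (simp add: abs_le_square_iff[symmetric])
        then have "(real (Suc n) * \<delta>)\<^sup>2 \<le> (real (Suc n) * u)\<^sup>2" by (simp add: power_mult_distrib mult_left_mono)
        then have "?k n u \<le> ?k n \<delta>" by (intro mult_left_mono) auto
        then show ?thesis by (auto simp: abs_mult intro!: mult_right_mono)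
      qed
      then have "(\<integral>u. norm (?k n u *\<^sub>R far u) \<partial>lborel) \<le> (\<integral>u. ?k n \<delta> * norm (far u) \<partial>lborel)"
        by (intro integral_mono integrable_norm integrable_mult_right k_int far_int)
      then show "norm (\<integral>u. ?k n u *\<^sub>R far u \<partial>lborel) \<le> ?k n \<delta> * (\<integral>u. norm (far u) \<partial>lborel)"
        using integral_norm_bound[of lborel "\<lambda>u. ?k n u *\<^sub>R far u"] by simp
    qed
    have "(\<lambda>n. ?k n \<delta>) \<longlonglongrightarrow> 0" using \<delta>(1) by real_asymp
    then show "(\<lambda>n. ?k n \<delta> * (\<integral>u. norm (far u) \<partial>lborel)) \<longlonglongrightarrow> 0"
      using tendsto_mult_left_zero by blast
  qed simp
  have "(\<integral>u. ?k n u *\<^sub>R h u \<partial>lborel) = (\<integral>u. ?k n u *\<^sub>R near u \<partial>lborel) + (\<integral>u. ?k n u *\<^sub>R far u \<partial>lborel)" for n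
  proof -
    have "h u = near u + far u" for u by (auto simp: near_def far_def indicator_def)
    then have "(\<integral>u. ?k n u *\<^sub>R h u \<partial>lborel) = (\<integral>u. ?k n u *\<^sub>R near u + ?k n u *\<^sub>R far u \<partial>lborel)"
      by (simp add: scaleR_add_right)
    then show ?thesis using k_int[OF near_int] k_int[OF far_int] by (simp add: Bochner_Integration.integral_add)
  qed
  then show ?thesis using tendsto_add[OF near_lim far_lim] by simp
qed

text \<open>
  Insert a Gaussian cut-off in the frequency variable and let it widen: on one side it
  disappears, on the other it is transformed into a Gaussian kernel concentrating at the
  origin.
\<close>

lemma fourier_inversion_at_0:
  fixes h :: "real \<Rightarrow> complex"
  assumes h: "integrable lborel h" and cont: "isCont h 0"
    and hat: "integrable lborel (\<lambda>t. \<integral>u. iexp (t * u) * h u \<partial>lborel)"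
  shows "(\<integral>t. \<integral>u. iexp (t * u) * h u \<partial>lborel \<partial>lborel) = 2 * pi * h 0"
proof -
  have [measurable]: "h \<in> borel_measurable borel" using h by (simp add: borel_measurable_integrable)
  let ?hat = "\<lambda>t. \<integral>u. iexp (t * u) * h u \<partial>lborel"
  let ?\<psi> = "\<lambda>n t. std_normal_density (t / real (Suc n))"
  have swap: "(\<integral>t. ?\<psi> n t *\<^sub>R ?hat t \<partial>lborel)
      = (\<integral>u. (real (Suc n) * exp (- (real (Suc n) * u)\<^sup>2 / 2)) *\<^sub>R h u \<partial>lborel)" for n
  proof -
    define F where "F = (\<lambda>t u. ?\<psi> n t *\<^sub>R (iexp (t * u) * h u))"
    have "integrable (lborel \<Otimes>\<^sub>M lborel) (case_prod F)"
    proof (rule integrable_pair_sheared_product[where a="?\<psi> n" and b="\<lambda>u. norm (h u)" and \<kappa>=0])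
      show "case_prod F \<in> borel_measurable (lborel \<Otimes>\<^sub>M lborel)" unfolding F_def by measurable
      show "integrable lborel (?\<psi> n)" by (intro gaussian_fourier) simp
    qed (use h in \<open>auto simp: F_def norm_mult\<close>)
    then have "(\<integral>t. \<integral>u. F t u \<partial>lborel \<partial>lborel) = (\<integral>u. \<integral>t. F t u \<partial>lborel \<partial>lborel)"
      by (rule lborel_pair.Fubini_integral[symmetric])
    moreover have "(\<integral>u. F t u \<partial>lborel) = ?\<psi> n t *\<^sub>R ?hat t" for t by (simp add: F_def)
    moreover have "(\<integral>t. F t u \<partial>lborel) = (real (Suc n) * exp (- (real (Suc n) * u)\<^sup>2 / 2)) *\<^sub>R h u" for u
    proof -
      have "(\<integral>t. F t u \<partial>lborel) = (\<integral>t. (?\<psi> n t *\<^sub>R iexp (t * u)) * h u \<partial>lborel)" by (simp add: F_def)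
      also have "\<dots> = (\<integral>t. ?\<psi> n t *\<^sub>R iexp (t * u) \<partial>lborel) * h u" by (rule integral_mult_left_zero)
      also have "\<dots> = (real (Suc n) * exp (- (real (Suc n) * u)\<^sup>2 / 2)) *\<^sub>R h u"
        by (subst gaussian_fourier(1)) (simp_all add: scaleR_conv_of_real)
      finally show ?thesis .
    qed
    ultimately show ?thesis by simp
  qed
  have "(\<lambda>n. \<integral>t. ?\<psi> n t *\<^sub>R ?hat t \<partial>lborel) \<longlonglongrightarrow> (\<integral>t. std_normal_density 0 *\<^sub>R ?hat t \<partial>lborel)"
  proof (rule integral_dominated_convergence[where w="\<lambda>t. std_normal_density 0 * norm (?hat t)"])
    show "AE t in lborel. (\<lambda>n. ?\<psi> n t *\<^sub>R ?hat t) \<longlonglongrightarrow> std_normal_density 0 *\<^sub>R ?hat t"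
    proof (intro AE_I2 tendsto_intros)
      fix t :: real
      have "(\<lambda>n. t / real (Suc n)) \<longlonglongrightarrow> 0" by real_asymp
      moreover have "isCont std_normal_density 0" unfolding normal_density_def by (intro continuous_intros) auto
      ultimately show "(\<lambda>n. ?\<psi> n t) \<longlonglongrightarrow> std_normal_density 0" using isCont_tendsto_compose by blast
    qed
    show "AE t in lborel. norm (?\<psi> n t *\<^sub>R ?hat t) \<le> std_normal_density 0 * norm (?hat t)" for n
      by (intro AE_I2) (auto simp: normal_density_def intro!: mult_left_le_one_le divide_right_mono)
  qed (use hat in auto)
  \<comment> \<open>The value \<open>1 / sqrt (2 pi)\<close> of the cut-off at the origin provides the constant \<open>2 pi\<close>.\<close>
  with gaussian_smoothing_tendsto[OF h cont]
  have "(\<integral>t. std_normal_density 0 *\<^sub>R ?hat t \<partial>lborel) = sqrt (2 * pi) * h 0"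
    unfolding swap by (blast intro: LIMSEQ_unique)
  then have "complex_of_real (1 / sqrt (2 * pi)) * (\<integral>t. ?hat t \<partial>lborel) = sqrt (2 * pi) * h 0"
    by (simp add: normal_density_def scaleR_conv_of_real)
  then have "of_real (sqrt (2 * pi)) * (complex_of_real (1 / sqrt (2 * pi)) * (\<integral>t. ?hat t \<partial>lborel))
      = of_real (sqrt (2 * pi)) * (sqrt (2 * pi) * h 0)" by (rule arg_cong)
  then have "(of_real (sqrt (2 * pi) * (1 / sqrt (2 * pi)))) * (\<integral>t. ?hat t \<partial>lborel)
      = of_real (sqrt (2 * pi) * sqrt (2 * pi)) * h 0" unfolding of_real_mult by (simp only: mult.assoc)
  then show ?thesis by simp
qed

text \<open>
  Continuity is assumed only at the point of interest; the proof of uniqueness for the Laplace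
  transform applies this to a function that may be unbounded near the origin.
\<close>

lemma fourier_inversion:
  fixes h :: "real \<Rightarrow> complex"
  assumes h: "integrable lborel h" and cont: "isCont h x"
    and hat: "integrable lborel (\<lambda>t. \<integral>u. iexp (t * u) * h u \<partial>lborel)"
  shows "(\<integral>t. iexp (- (t * x)) * (\<integral>u. iexp (t * u) * h u \<partial>lborel) \<partial>lborel) = 2 * pi * h x"
proof -
  have eq: "(\<integral>u. iexp (t * u) * h (x + u) \<partial>lborel) = iexp (- (t * x)) * (\<integral>u. iexp (t * u) * h u \<partial>lborel)" for t
  proof -
    have "(\<integral>u. iexp (t * u) * h (x + u) \<partial>lborel) = (\<integral>u. iexp (- (t * x)) * (iexp (t * (x + u)) * h (x + u)) \<partial>lborel)"
      by (intro Bochner_Integration.integral_cong) (auto simp: exp_add[symmetric] algebra_simps)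
    also have "\<dots> = iexp (- (t * x)) * (\<integral>u. iexp (t * (x + u)) * h (x + u) \<partial>lborel)"
      by (rule integral_mult_right_zero)
    also have "(\<integral>u. iexp (t * (x + u)) * h (x + u) \<partial>lborel) = (\<integral>u. iexp (t * u) * h u \<partial>lborel)"
      using lborel_integral_real_affine[of 1 "\<lambda>u. iexp (t * u) * h u" x] by simp
    finally show ?thesis .
  qed
  have "integrable lborel (\<lambda>t. iexp (- (t * x)) * (\<integral>u. iexp (t * u) * h u \<partial>lborel))"
    by (rule Bochner_Integration.integrable_bound[OF hat])
       (use hat in \<open>auto intro!: AE_I2 borel_measurable_times borel_measurable_integrable[OF hat, simplified] simp: norm_mult\<close>)
  moreover have "integrable lborel (\<lambda>u. h (x + u))"
    using lborel_integrable_real_affine[OF h, of 1 x] by simp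
  moreover have "isCont (\<lambda>u. h (x + u)) 0" using cont by (simp add: isCont_def LIM_offset_zero_iff)
  ultimately show ?thesis
    using fourier_inversion_at_0[of "\<lambda>u. h (x + u)"] unfolding eq by simp
qed

section \<open>The exponential substitution and the gamma function\<close>

lemma exp_substitution:
  fixes g :: "real \<Rightarrow> complex"
  shows set_integrable_exp_substitution:
      "set_integrable lebesgue {0<..} g \<longleftrightarrow> integrable lebesgue (\<lambda>u. exp u *\<^sub>R g (exp u))" (is ?A)
    and set_integral_exp_substitution:
      "integrable lebesgue (\<lambda>u. exp u *\<^sub>R g (exp u)) \<Longrightarrow>
        (LINT x:{0<..}|lebesgue. g x) = (\<integral>u. exp u *\<^sub>R g (exp u) \<partial>lebesgue)" (is "_ \<Longrightarrow> ?B")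
proof -
  have range: "range (exp :: real \<Rightarrow> real) = {0<..}"
    by (auto simp: image_iff) (metis exp_ln)
  have CoV: "(\<lambda>u. \<bar>exp u\<bar> *\<^sub>R g (exp u)) absolutely_integrable_on UNIV
       \<and> integral UNIV (\<lambda>u. \<bar>exp u\<bar> *\<^sub>R g (exp u)) = b
     \<longleftrightarrow> g absolutely_integrable_on {0<..} \<and> integral {0<..} g = b" for b
    unfolding range[symmetric]
    by (rule has_absolute_integral_change_of_variables_real)
       (auto simp: inj_on_def intro!: derivative_eq_intros)
  show ?A using CoV by (auto simp: set_integrable_def)
  assume int: "integrable lebesgue (\<lambda>u. exp u *\<^sub>R g (exp u))"
  then have *: "(\<lambda>u. exp u *\<^sub>R g (exp u)) absolutely_integrable_on UNIV" by (simp add: set_integrable_def)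
  with CoV have "g absolutely_integrable_on {0<..}" 
    and eq: "integral {0<..} g = integral UNIV (\<lambda>u. exp u *\<^sub>R g (exp u))" by auto
  then show ?B
    using set_lebesgue_integral_eq_integral(2)[OF *] set_lebesgue_integral_eq_integral(2)[of "{0<..}" g]
    by (simp add: set_lebesgue_integral_def)
qed

lemma Re_pos_not_nonpos_Int:
  assumes "Re w > 0" shows "w \<notin> \<int>\<^sub>\<le>\<^sub>0"
proof
  assume "w \<in> \<int>\<^sub>\<le>\<^sub>0"
  then obtain n where "w = of_int n" "n \<le> 0" by (auto elim!: nonpos_Ints_cases)
  then show False using assms by simp
qed

lemma borel_measurable_Gamma [measurable]: "(Gamma :: complex \<Rightarrow> complex) \<in> borel_measurable borel"
proof -
  have "(\<lambda>z. inverse (rGamma z :: complex)) \<in> borel_measurable borel"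
    by (intro borel_measurable_inverse borel_measurable_continuous_onI continuous_on_rGamma)
  then show ?thesis by (simp add: Gamma_def[abs_def])
qed

lemma borel_measurable_Complex [measurable]:
  assumes "g \<in> borel_measurable M" shows "(\<lambda>x. Complex a (g x)) \<in> borel_measurable M"
proof -
  have "(\<lambda>x. Complex a (g x)) = (\<lambda>x. of_real a + \<i> * of_real (g x))" by (simp add: Complex_eq)
  with assms show ?thesis by simp
qed

text \<open>
  Euler's integral after the substitution \<open>t = exp u\<close>.
\<close>

lemma Gamma_log_integral:
  assumes s: "Re s > 0"
  shows "integrable lborel (\<lambda>u. exp (s * of_real u - of_real (exp u)))"
    and "(\<integral>u. exp (s * of_real u - of_real (exp u)) \<partial>lborel) = Gamma s"
proof -
  define g where "g = (\<lambda>t::real. complex_of_real t powr (s - 1) / of_real (exp t))"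
  have g: "exp u *\<^sub>R g (exp u) = exp (s * of_real u - of_real (exp u))" for u
    by (simp add: g_def powr_def scaleR_conv_of_real exp_of_real[symmetric] Ln_of_real exp_diff[symmetric] exp_add[symmetric] algebra_simps)
  have int: "set_integrable lebesgue {0<..} g" unfolding g_def
    using absolutely_integrable_Gamma_integral'[OF s] .
  then have int': "integrable lebesgue (\<lambda>u. exp (s * of_real u - of_real (exp u)))"
    unfolding set_integrable_exp_substitution g .
  then show i: "integrable lborel (\<lambda>u. exp (s * of_real u - of_real (exp u)))"
    by (intro integrable_lebesgue_imp_lborel) measurable
  have "Gamma s = (LINT x:{0<..}|lebesgue. g x)"
    using Gamma_integral_complex'[OF s] set_lebesgue_integral_eq_integral(2)[OF int]
    unfolding g_def by (simp add: integral_unique)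
  also have "\<dots> = (\<integral>u. exp (s * of_real u - of_real (exp u)) \<partial>lebesgue)"
    using int int' set_integral_exp_substitution[of g] unfolding g by simp
  also have "\<dots> = (\<integral>u. exp (s * of_real u - of_real (exp u)) \<partial>lborel)"
    using i by (rule integrable_lborel_imp_lebesgue)
  finally show "(\<integral>u. exp (s * of_real u - of_real (exp u)) \<partial>lborel) = Gamma s" by simp
qed

lemma Gamma_log_integral_real:
  fixes a :: real
  assumes "a > 0"
  shows "integrable lborel (\<lambda>u. exp (a * u - exp u))"
    and "(\<integral>u. exp (a * u - exp u) \<partial>lborel) = Gamma a"
proof -
  have eq: "exp (complex_of_real a * of_real u - of_real (exp u)) = of_real (exp (a * u - exp u))" for u
    by (simp flip: exp_of_real)
  show 1: "integrable lborel (\<lambda>u. exp (a * u - exp u))"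
    using integrable_Re[OF Gamma_log_integral(1)[of "of_real a"]] assms unfolding eq by simp
  show "(\<integral>u. exp (a * u - exp u) \<partial>lborel) = Gamma a"
    using Gamma_log_integral(2)[of "of_real a"] assms unfolding eq
    by (simp add: Gamma_complex_of_real)
qed

lemma norm_Gamma_le_Gamma_Re:
  assumes "Re s > 0"
  shows "norm (Gamma s) \<le> Gamma (Re s)"
proof -
  have "norm (Gamma s) \<le> (\<integral>u. norm (exp (s * of_real u - of_real (exp u))) \<partial>lborel)"
    unfolding Gamma_log_integral(2)[OF assms, symmetric] by (rule integral_norm_bound)
  also have "\<dots> = Gamma (Re s)"
    using Gamma_log_integral_real(2)[OF assms] by simp
  finally show ?thesis .
qed

text \<open>
  In the original coordinate \<open>t = exp u\<close> with \<open>p = exp q\<close> this is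
  \<open>\<integral> t powr (s - 1) * exp (- p t powr k) dt\<close>: for \<open>k = 1\<close> the Laplace transform of a power,
  for \<open>q = 0\<close> and \<open>k = m\<close> the Mellin transform of \<open>exp (- t ^ m)\<close>.
\<close>

lemma exp_log_integral_affine:
  assumes "Re s > 0" and "k > 0"
  shows "integrable lborel (\<lambda>u. exp (s * of_real u - of_real (exp (k * u + q))))"
    and "(\<integral>u. exp (s * of_real u - of_real (exp (k * u + q))) \<partial>lborel) = Gamma (s / of_real k) * exp (- s * of_real (q / k)) / of_real k"
proof -
  let ?g = "\<lambda>u. exp (s / of_real k * of_real u - of_real (exp u))"
  have pos: "Re (s / of_real k) > 0" using assms by (simp add: Re_divide_of_real)
  have eq: "exp (- s * of_real (q / k)) * ?g (q + k * u) = exp (s * of_real u - of_real (exp (k * u + q)))" for u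
  proof -
    have "s / of_real k * of_real (q + k * u) = s * of_real (q / k) + s * of_real u"
      using assms(2) by (simp add: field_simps)
    then show ?thesis by (simp add: exp_add[symmetric] add.commute)
  qed
  note g = Gamma_log_integral[OF pos]
  have "integrable lborel (\<lambda>u. ?g (q + k * u))"
    using lborel_integrable_real_affine[OF g(1), of k q] assms(2) by simp
  then show "integrable lborel (\<lambda>u. exp (s * of_real u - of_real (exp (k * u + q))))"
    unfolding eq[symmetric] by (rule integrable_mult_right)
  have "Gamma (s / of_real k) = of_real k * (\<integral>u. ?g (q + k * u) \<partial>lborel)"
    unfolding g(2)[symmetric] using assms(2) lborel_integral_real_affine[of k ?g q] by (simp add: scaleR_conv_of_real)
  moreover have "(\<integral>u. exp (s * of_real u - of_real (exp (k * u + q))) \<partial>lborel) = exp (- s * of_real (q / k)) * (\<integral>u. ?g (q + k * u) \<partial>lborel)"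
    unfolding eq[symmetric] by (rule integral_mult_right_zero)
  ultimately show "(\<integral>u. exp (s * of_real u - of_real (exp (k * u + q))) \<partial>lborel) = Gamma (s / of_real k) * exp (- s * of_real (q / k)) / of_real k"
    using assms(2) by simp
qed

lemma exp_log_integral_affine_real:
  assumes "a > 0" and "k > 0"
  shows "integrable lborel (\<lambda>u::real. exp (a * u - exp (k * u + q)))"
    and "(\<integral>u. exp (a * u - exp (k * u + q)) \<partial>lborel) = Gamma (a / k) * exp (- a * (q / k)) / k"
proof -
  have eq: "exp (complex_of_real a * of_real u - of_real (exp (k * u + q))) = of_real (exp (a * u - exp (k * u + q)))" for u
    by (simp flip: exp_of_real)
  have a: "Re (of_real a) > 0" using assms by simp
  show "integrable lborel (\<lambda>u::real. exp (a * u - exp (k * u + q)))"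
    using integrable_Re[OF exp_log_integral_affine(1)[OF a assms(2), of q]] unfolding eq by simp
  have "complex_of_real (\<integral>u. exp (a * u - exp (k * u + q)) \<partial>lborel) = of_real (Gamma (a / k) * exp (- a * (q / k)) / k)"
    using exp_log_integral_affine(2)[OF a assms(2), of q] unfolding eq integral_complex_of_real
    by (simp add: Gamma_complex_of_real[symmetric] exp_of_real[symmetric])
  then show "(\<integral>u. exp (a * u - exp (k * u + q)) \<partial>lborel) = Gamma (a / k) * exp (- a * (q / k)) / k"
    by (simp only: of_real_eq_iff)
qed

lemma continuous_on_Gamma_vertical: 
  assumes "\<sigma> > 0"
  shows "continuous_on UNIV (\<lambda>t. Gamma (Complex \<sigma> t))"
  by (rule continuous_on_compose2[OF continuous_on_Gamma[of "{s. Re s > 0}"]])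
     (use assms in \<open>auto intro!: continuous_intros simp: Complex_eq elim!: nonpos_Ints_cases\<close>)

text \<open>
  Two steps of the functional equation express \<open>\<Gamma>(s)\<close> as \<open>\<Gamma>(s + 2) / (s (s + 1))\<close>, where the
  numerator is bounded on the line and the denominator grows quadratically.
\<close>

lemma integrable_Gamma_vertical:
  assumes \<sigma>: "\<sigma> > 0"
  shows "integrable lborel (\<lambda>t. Gamma (Complex \<sigma> t))"
proof (rule Bochner_Integration.integrable_bound)
  show "(\<lambda>t. Gamma (Complex \<sigma> t)) \<in> borel_measurable lborel"
    using continuous_on_Gamma_vertical[OF \<sigma>] borel_measurable_continuous_onI by simp
  have "integrable lborel (\<lambda>t::real. inverse (1 + t\<^sup>2))"
  proof -
    have "set_integrable lborel (einterval (-\<infinity>) \<infinity>) (\<lambda>x::real. inverse (1 + x\<^sup>2))"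
      by (rule integrable_inverse_1_plus_square)
    then show ?thesis by (simp add: set_integrable_def)
  qed
  then show "integrable lborel (\<lambda>t. Gamma (\<sigma> + 2) / min 1 (\<sigma>\<^sup>2) * inverse (1 + t\<^sup>2))"
    by simp
  show "AE t in lborel. norm (Gamma (Complex \<sigma> t)) \<le> norm (Gamma (\<sigma> + 2) / min 1 (\<sigma>\<^sup>2) * inverse (1 + t\<^sup>2))"
  proof (rule AE_I2)
    fix t
    let ?s = "Complex \<sigma> t"
    have nz: "?s \<noteq> 0" "?s + 1 \<noteq> 0" and nonpos: "?s \<notin> \<int>\<^sub>\<le>\<^sub>0" "?s + 1 \<notin> \<int>\<^sub>\<le>\<^sub>0"
      using \<sigma> by (auto simp: complex_eq_iff elim!: nonpos_Ints_cases)
    have "Gamma (?s + 2) = (?s + 1) * (?s * Gamma ?s)"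
      using Gamma_plus1[OF nonpos(1)] Gamma_plus1[OF nonpos(2)] by (simp add: add.assoc)
    then have "norm (?s + 1) * norm ?s * norm (Gamma ?s) = norm (Gamma (?s + 2))" by (simp add: norm_mult)
    also have "\<dots> \<le> Gamma (\<sigma> + 2)" using norm_Gamma_le_Gamma_Re[of "?s + 2"] \<sigma> by simp
    finally have 1: "norm (?s + 1) * norm ?s * norm (Gamma ?s) \<le> Gamma (\<sigma> + 2)" .
    have "norm ?s \<le> norm (?s + 1)" using \<sigma> by (auto simp: cmod_def)
    then have "(norm ?s)\<^sup>2 \<le> norm (?s + 1) * norm ?s" by (simp add: power2_eq_square mult_right_mono)
    moreover have "min 1 (\<sigma>\<^sup>2) * (1 + t\<^sup>2) \<le> (norm ?s)\<^sup>2"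
    proof -
      have "min 1 (\<sigma>\<^sup>2) * (1 + t\<^sup>2) \<le> \<sigma>\<^sup>2 + t\<^sup>2"
        by (auto simp: distrib_left min_def intro: mult_left_le_one_le)
      then show ?thesis by (simp add: cmod_power2)
    qed
    ultimately have "min 1 (\<sigma>\<^sup>2) * (1 + t\<^sup>2) * norm (Gamma ?s) \<le> norm (?s + 1) * norm ?s * norm (Gamma ?s)"
      by (intro mult_right_mono) auto
    with 1 have "min 1 (\<sigma>\<^sup>2) * (1 + t\<^sup>2) * norm (Gamma ?s) \<le> Gamma (\<sigma> + 2)" by linarith
    moreover have "min 1 (\<sigma>\<^sup>2) > 0" "1 + t\<^sup>2 > 0" using \<sigma> by (auto simp: add_pos_nonneg)
    ultimately have "norm (Gamma ?s) \<le> Gamma (\<sigma> + 2) / (min 1 (\<sigma>\<^sup>2) * (1 + t\<^sup>2))"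
      by (simp add: pos_le_divide_eq mult.commute)
    also have "\<dots> = Gamma (\<sigma> + 2) / min 1 (\<sigma>\<^sup>2) * inverse (1 + t\<^sup>2)" by (simp add: field_simps)
    also have "\<dots> \<le> norm (Gamma (\<sigma> + 2) / min 1 (\<sigma>\<^sup>2) * inverse (1 + t\<^sup>2))" by (simp only: real_norm_def abs_ge_self)
    finally show "norm (Gamma ?s) \<le> norm (Gamma (\<sigma> + 2) / min 1 (\<sigma>\<^sup>2) * inverse (1 + t\<^sup>2))" .
  qed
qed

text \<open>
  The gamma function on the line \<open>Re s = \<sigma>\<close> is the Fourier transform of \<open>exp (\<sigma> u - exp u)\<close>.
\<close>

lemma cahen_mellin:
  assumes \<sigma>: "\<sigma> > 0"
  shows "(\<integral>t. Gamma (Complex \<sigma> t) * exp (- (Complex \<sigma> t * of_real x)) \<partial>lborel) = 2 * pi * exp (- exp x)"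
proof -
  define h where "h = (\<lambda>u. exp (complex_of_real \<sigma> * of_real u - of_real (exp u)))"
  have hat: "(\<integral>u. iexp (t * u) * h u \<partial>lborel) = Gamma (Complex \<sigma> t)" for t
  proof -
    have "iexp (t * u) * h u = exp (Complex \<sigma> t * of_real u - of_real (exp u))" for u
      by (simp add: h_def exp_add[symmetric] Complex_eq algebra_simps)
    then show ?thesis using Gamma_log_integral(2)[of "Complex \<sigma> t"] \<sigma> by simp
  qed
  have "(\<integral>t. iexp (- (t * x)) * (\<integral>u. iexp (t * u) * h u \<partial>lborel) \<partial>lborel) = 2 * pi * h x"
  proof (rule fourier_inversion)
    show "integrable lborel h" unfolding h_def using \<sigma> by (intro Gamma_log_integral) simp
    show "isCont h x" unfolding h_def by (intro continuous_intros)
    show "integrable lborel (\<lambda>t. \<integral>u. iexp (t * u) * h u \<partial>lborel)"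
      unfolding hat by (rule integrable_Gamma_vertical[OF \<sigma>])
  qed
  moreover have e: "exp (- complex_of_real (\<sigma> * x)) * iexp (- (t * x)) = exp (- (Complex \<sigma> t * of_real x))" for t
    by (simp add: exp_add[symmetric] Complex_eq algebra_simps)
  ultimately have "exp (- complex_of_real (\<sigma> * x)) * (\<integral>t. iexp (- (t * x)) * Gamma (Complex \<sigma> t) \<partial>lborel) = exp (- complex_of_real (\<sigma> * x)) * (2 * pi * h x)"
    unfolding hat by simp
  also have "exp (- complex_of_real (\<sigma> * x)) * (\<integral>t. iexp (- (t * x)) * Gamma (Complex \<sigma> t) \<partial>lborel)
     = (\<integral>t. exp (- complex_of_real (\<sigma> * x)) * (iexp (- (t * x)) * Gamma (Complex \<sigma> t)) \<partial>lborel)"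
    by simp
  also have "\<dots> = (\<integral>t. Gamma (Complex \<sigma> t) * exp (- (Complex \<sigma> t * of_real x)) \<partial>lborel)"
    unfolding e[symmetric] by (simp only: mult_ac)
  also have "exp (- complex_of_real (\<sigma> * x)) * (2 * pi * h x) = 2 * pi * exp (- exp x)"
    by (simp add: h_def exp_diff exp_minus exp_of_real[symmetric] field_simps)
  finally show ?thesis .
qed

section \<open>Gauss' multiplication formula\<close>

text \<open>
  Cancel the factor \<open>X - 1\<close> in the factorisation of \<open>X ^ m - 1\<close> and evaluate at 1.
\<close>

lemma prod_one_minus_roots_of_unity:
  assumes m: "m \<ge> 1"
  shows "(\<Prod>k\<in>{1..<m}. 1 - exp (2 * of_real pi * \<i> * of_nat k / of_nat m)) = (of_nat m :: complex)"
proof -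
  define w where "w k = exp (2 * of_real pi * \<i> * of_nat k / of_nat m)" for k :: nat
  have w0: "w 0 = 1" by (simp add: w_def)
  have w_pow: "w k ^ m = 1" for k unfolding w_def using m by (intro complex_root_unity) auto
  define p where "p = (\<Prod>k<m. [:- w k, 1:])"
  have deg: "degree p = m" unfolding p_def by (subst degree_prod_eq_sum_degree) auto
  have "p = monom 1 m - 1"
  proof (rule poly_eqI_degree_lead_coeff[where n=m and A="w ` {..<m}"])
    have "lead_coeff p = 1" unfolding p_def lead_coeff_prod by simp
    then show "coeff p m = coeff (monom 1 m - 1) m" using deg m by simp
    have "inj_on w {..<m}"
      using m by (auto simp: inj_on_def w_def complex_root_unity_eq)
    then show "m \<le> card (w ` {..<m})" by (simp add: card_image)
    show "degree p \<le> m" using deg by simp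
    show "degree (monom 1 m - 1 :: complex poly) \<le> m"
      by (intro degree_diff_le degree_monom_le) auto
    show "poly p z = poly (monom 1 m - 1) z" if z: "z \<in> w ` {..<m}" for z
    proof -
      have "poly p z = 0" using z by (auto simp: p_def poly_prod)
      moreover have "poly (monom 1 m - 1) z = 0" using z w_pow by (auto simp: poly_monom)
      ultimately show ?thesis by simp
    qed
  qed
  also have "monom 1 m - 1 = [:-1, 1:] * (\<Sum>j<m. monom (1::complex) j)"
  proof (rule poly_eq_poly_eq_iff[THEN iffD1], rule ext)
    show "poly (monom 1 m - 1) x = poly ([:-1, 1:] * (\<Sum>j<m. monom (1::complex) j)) x" for x :: complex
      using power_diff_1_eq[of x m] by (simp add: poly_monom poly_sum algebra_simps)
  qed
  finally have p_eq: "p = [:-1, 1:] * (\<Sum>j<m. monom (1::complex) j)" .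
  have "{..<m} = insert 0 {1..<m}" using m by auto
  then have "p = [:-1, 1:] * (\<Prod>k\<in>{1..<m}. [:- w k, 1:])" using w0 by (simp add: p_def)
  with p_eq have "(\<Prod>k\<in>{1..<m}. [:- w k, 1:]) = (\<Sum>j<m. monom (1::complex) j)"
    by (metis mult_cancel_left pCons_eq_0_iff one_neq_zero)
  then have "poly (\<Prod>k\<in>{1..<m}. [:- w k, 1:]) 1 = poly (\<Sum>j<m. monom (1::complex) j) 1" by simp
  then show ?thesis by (simp add: poly_prod poly_sum poly_monom w_def)
qed

lemma prod_sin_pi_fractions:
  assumes m: "m \<ge> 1"
  shows "(\<Prod>k\<in>{1..<m}. 2 * sin (pi * real k / real m)) = real m"
proof -
  have factor: "norm (1 - exp (2 * of_real pi * \<i> * of_nat k / of_nat m)) = 2 * sin (pi * real k / real m)"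
    if k: "k \<in> {1..<m}" for k
  proof -
    have "norm (1 - exp (2 * of_real pi * \<i> * of_nat k / of_nat m))
        = norm (exp (\<i> * of_real (2 * pi * real k / real m)) - 1)"
      by (simp add: norm_minus_commute mult_ac)
    also have "\<dots> = 2 * \<bar>sin (pi * real k / real m)\<bar>" unfolding dist_exp_i_1 by simp
    also have "sin (pi * real k / real m) > 0"
      using k by (intro sin_gt_zero) (auto simp: field_simps)
    then have "\<bar>sin (pi * real k / real m)\<bar> = sin (pi * real k / real m)" by simp
    finally show ?thesis .
  qed
  have "(\<Prod>k\<in>{1..<m}. 2 * sin (pi * real k / real m))
      = norm (\<Prod>k\<in>{1..<m}. 1 - exp (2 * of_real pi * \<i> * of_nat k / of_nat m))"
    unfolding prod_norm[symmetric] by (intro prod.cong) (use factor in auto)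
  then show ?thesis unfolding prod_one_minus_roots_of_unity[OF m] by simp
qed

text \<open>
  Pairing \<open>k\<close> with \<open>m - k\<close>, the reflection formula expresses the square of the product through
  the product of sines.
\<close>

lemma prod_Gamma_fractions:
  assumes m: "m \<ge> 1"
  shows "real m * (\<Prod>k<m. Gamma (real (Suc k) / real m)) = (2 * pi) powr ((real m - 1) / 2) * sqrt (real m)"
proof -
  define P where "P = (\<Prod>k\<in>{1..<m}. Gamma (real k / real m))"
  have P_pos: "P > 0" unfolding P_def using m by (intro prod_pos) auto
  have "(\<Prod>k<m. Gamma (real (Suc k) / real m)) = (\<Prod>k\<in>{1..m}. Gamma (real k / real m))"
    by (rule prod.reindex_bij_witness[of _ "\<lambda>k. k - 1" Suc]) auto
  also have "{1..m} = insert m {1..<m}" using m by auto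
  finally have P: "(\<Prod>k<m. Gamma (real (Suc k) / real m)) = P" using m by (simp add: P_def)
  \<comment> \<open>The same product in reverse order, \<open>k\<close> replaced by \<open>m - k\<close>.\<close>
  have refl: "P = (\<Prod>k\<in>{1..<m}. Gamma (1 - real k / real m))"
    unfolding P_def
    by (rule prod.reindex_bij_witness[of _ "\<lambda>k. m - k" "\<lambda>k. m - k"]) (use m in \<open>auto simp: of_nat_diff field_simps\<close>)
  have reflection: "Gamma (real k / real m) * Gamma (1 - real k / real m) = 2 * pi / (2 * sin (pi * real k / real m))" for k
  proof -
    have "complex_of_real (Gamma (real k / real m) * Gamma (1 - real k / real m)) = of_real (2 * pi / (2 * sin (pi * real k / real m)))"
      using Gamma_reflection_complex[of "of_real (real k / real m)"]
      by (simp flip: Gamma_complex_of_real sin_of_real)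
    then show ?thesis by (simp only: of_real_eq_iff)
  qed
  have "P * P = (\<Prod>k\<in>{1..<m}. Gamma (real k / real m) * Gamma (1 - real k / real m))"
    by (subst (2) refl) (simp add: P_def prod.distrib)
  also have "\<dots> = (2 * pi) ^ (m - 1) / real m"
    unfolding reflection prod_dividef prod_sin_pi_fractions[OF m] by simp
  finally have "(real m * P)\<^sup>2 = (2 * pi) ^ (m - 1) * real m"
    using m by (simp add: power2_eq_square field_simps)
  also have "\<dots> = ((2 * pi) powr ((real m - 1) / 2) * sqrt (real m))\<^sup>2"
  proof -
    have "((2 * pi) powr ((real m - 1) / 2))\<^sup>2 = (2 * pi) powr (real m - 1)"
      by (simp add: power2_eq_square powr_add[symmetric])
    also have "\<dots> = (2 * pi) ^ (m - 1)" using powr_realpow[of "2 * pi" "m - 1"] m by (simp add: of_nat_diff)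
    finally show ?thesis by (simp add: power_mult_distrib)
  qed
  finally have sq: "(real m * P)\<^sup>2 = ((2 * pi) powr ((real m - 1) / 2) * sqrt (real m))\<^sup>2" .
  have "real m * P = (2 * pi) powr ((real m - 1) / 2) * sqrt (real m)"
    by (rule power2_eq_imp_eq[OF sq]) (use P_pos in simp_all)
  then show ?thesis unfolding P .
qed

lemma pochhammer_times:
  fixes z :: "'a :: field_char_0"
  assumes m: "m \<ge> 1"
  shows "pochhammer (of_nat m * z) (m * n) = of_nat m ^ (m * n) * (\<Prod>k<m. pochhammer (z + of_nat k / of_nat m) n)"
proof (induction n)
  case (Suc n)
  have "pochhammer (of_nat m * z) (m * Suc n) = pochhammer (of_nat m * z) (m * n) * pochhammer (of_nat m * z + of_nat (m * n)) m"
    using pochhammer_product'[of "of_nat m * z" "m * n" m] by (simp add: add.commute)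
  also have "pochhammer (of_nat m * z + of_nat (m * n)) m = (\<Prod>k<m. of_nat m * (z + of_nat k / of_nat m + of_nat n))"
    unfolding pochhammer_prod lessThan_atLeast0
    using m by (intro prod.cong) (auto simp: field_simps)
  also have "\<dots> = of_nat m ^ m * (\<Prod>k<m. z + of_nat k / of_nat m + of_nat n)"
    by (simp add: prod.distrib)
  finally show ?case unfolding Suc.IH
    by (simp add: pochhammer_Suc prod.distrib power_add mult_ac)
qed simp

text \<open>
  In Gauss' limit formula the quotient of both sides is the limit of a sequence in which \<open>z\<close>
  cancels, so the quotient is a constant; its value is found at \<open>z = 1 / m\<close>.
\<close>

lemma Gamma_multiplication:
  fixes z :: complex
  assumes m: "m \<ge> 1" and z: "of_nat m * z \<notin> \<int>\<^sub>\<le>\<^sub>0"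
  shows "(\<Prod>k<m. Gamma (z + of_nat k / of_nat m))
       = of_real ((2 * pi) powr ((real m - 1) / 2) * sqrt (real m)) * exp (- (of_nat m * z * of_real (ln (real m)))) * Gamma (of_nat m * z)"
proof -
  \<comment> \<open>The sequence from which \<open>z\<close> has cancelled, and the quotient of the two sides.\<close>
  let ?h = "\<lambda>n. fact (n - 1) ^ m * of_nat m ^ (m * n) * exp (of_real ((real m - 1) / 2 * ln (real n))) / fact (m * n - 1) :: complex"
  let ?L = "\<lambda>z. exp (of_nat m * z * of_real (ln (real m))) * (\<Prod>k<m. Gamma (z + of_nat k / of_nat m)) / Gamma (of_nat m * z)"
  have nonpos: "z + of_nat k / of_nat m \<notin> \<int>\<^sub>\<le>\<^sub>0" if z: "of_nat m * z \<notin> \<int>\<^sub>\<le>\<^sub>0" for z :: complex and k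
  proof
    assume "z + of_nat k / of_nat m \<in> \<int>\<^sub>\<le>\<^sub>0"
    then obtain j where "z + of_nat k / of_nat m = - of_nat j" by (auto elim: nonpos_Ints_cases')
    moreover have "of_nat m * z = of_nat m * (z + of_nat k / of_nat m) - of_nat k"
      using m by (simp add: distrib_left)
    ultimately have "of_nat m * z = - of_nat (m * j + k)" by simp
    then show False using z minus_of_nat_in_nonpos_Ints[of "m * j + k", where 'a=complex] by metis
  qed
  have lim: "?h \<longlonglongrightarrow> ?L z" if z: "of_nat m * z \<notin> \<int>\<^sub>\<le>\<^sub>0" for z
  proof -
    let ?g = "\<lambda>n. exp (of_nat m * z * of_real (ln (real m))) * (\<Prod>k<m. Gamma_series' (z + of_nat k / of_nat m) n) / Gamma_series' (of_nat m * z) (m * n)"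
    have "eventually (\<lambda>n. ?g n = ?h n) sequentially" using eventually_gt_at_top[of 0]
    proof eventually_elim
      fix n :: nat assume n: "n > 0"
      define Q where "Q = (\<Prod>k<m. pochhammer (z + of_nat k / of_nat m) n)"
      have Q: "Q \<noteq> 0" unfolding Q_def using nonpos[OF z] by (auto dest: pochhammer_eq_0_imp_nonpos_Int)
      have sum: "(\<Sum>k<m. z + of_nat k / of_nat m) = of_nat m * z + of_real ((real m - 1) / 2)"
      proof -
        have "(\<Sum>k<m. real k) = real m * (real m - 1) / 2" by (induction m) (auto simp: field_simps)
        then have "(\<Sum>k<m. real k / real m) = (real m - 1) / 2"
          unfolding sum_divide_distrib[symmetric] using m by simp
        then have "complex_of_real (\<Sum>k<m. real k / real m) = of_real ((real m - 1) / 2)" by (rule arg_cong)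
        then show ?thesis by (simp add: sum.distrib)
      qed
      have A: "(\<Prod>k<m. Gamma_series' (z + of_nat k / of_nat m) n)
          = fact (n - 1) ^ m * exp ((of_nat m * z + of_real ((real m - 1) / 2)) * of_real (ln (real n))) / Q"
        unfolding Gamma_series'_def Q_def sum[symmetric]
        by (simp add: prod_dividef prod.distrib sum_distrib_right exp_sum)
      have B: "Gamma_series' (of_nat m * z) (m * n)
          = fact (m * n - 1) * exp (of_nat m * z * of_real (ln (real m))) * exp (of_nat m * z * of_real (ln (real n))) / (of_nat m ^ (m * n) * Q)"
        unfolding Gamma_series'_def pochhammer_times[OF m] Q_def
        using m n by (simp add: ln_mult exp_add distrib_left)
      have C: "exp ((of_nat m * z + of_real ((real m - 1) / 2)) * of_real (ln (real n)))
          = exp (of_nat m * z * of_real (ln (real n))) * exp (of_real ((real m - 1) / 2 * ln (real n)))"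
        by (simp add: exp_add[symmetric] distrib_right)
      have cancel: "E1 * (F * (E2 * H) / R) / (G * E1 * E2 / (M * R)) = F * M * H / G"
        if "E1 \<noteq> 0" "E2 \<noteq> 0" "R \<noteq> 0" "M \<noteq> 0" "G \<noteq> 0" for E1 E2 F G H M R :: complex
        using that by (simp add: field_simps)
      show "?g n = ?h n" unfolding A B C
        by (rule cancel) (use Q m in auto)
    qed
    moreover have "?g \<longlonglongrightarrow> ?L z"
    proof (intro tendsto_intros Gamma_series'_LIMSEQ)
      show "(\<lambda>n. Gamma_series' (of_nat m * z) (m * n)) \<longlonglongrightarrow> Gamma (of_nat m * z)"
        using LIMSEQ_subseq_LIMSEQ[OF Gamma_series'_LIMSEQ, of "(*) m" "of_nat m * z"] m
        by (simp add: o_def strict_mono_def)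
      show "Gamma (of_nat m * z) \<noteq> 0" using z by (simp add: Gamma_eq_zero_iff)
    qed
    ultimately show ?thesis by (blast intro: Lim_transform_eventually)
  qed
  have one: "of_nat m * (1 / of_nat m) = (1 :: complex)" using m by simp
  have "?L z = ?L (1 / of_nat m)"
    by (rule LIMSEQ_unique[OF lim[OF z] lim]) (use one in simp)
  also have "?L (1 / of_nat m) = complex_of_real (real m * (\<Prod>k<m. Gamma (real (Suc k) / real m)))"
  proof -
    have "Gamma (1 / of_nat m + of_nat k / of_nat m) = complex_of_real (Gamma (real (Suc k) / real m))" for k
      by (subst Gamma_complex_of_real[symmetric]) (simp add: add_divide_distrib)
    then show ?thesis unfolding one using m by (simp add: exp_of_real)
  qed
  also have "\<dots> = of_real ((2 * pi) powr ((real m - 1) / 2) * sqrt (real m))"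
    unfolding prod_Gamma_fractions[OF m] ..
  finally show ?thesis using z
    by (simp add: Gamma_eq_zero_iff exp_minus field_simps)
qed

section \<open>The kernel as a Mellin-Barnes integral\<close>

text \<open>
  The kernel \<open>\<integral> exp (- x / t - t ^ m) t powr (z - 1) dt\<close> in the coordinates \<open>x = exp u\<close>,
  \<open>t = exp v\<close>.
\<close>

definition index_kernel :: "nat \<Rightarrow> complex \<Rightarrow> real \<Rightarrow> complex" where
  "index_kernel m z u = (\<integral>v. exp (z * of_real v - of_real (exp (real m * v)) - of_real (exp (u - v))) \<partial>lborel)"

definition meijer_const :: "nat \<Rightarrow> real" where
  "meijer_const m = (2 * pi) powr ((1 - real m) / 2) / sqrt (real m)"

lemma meijer_const_pos: "m \<ge> 1 \<Longrightarrow> meijer_const m > 0"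
  by (simp add: meijer_const_def)

text \<open>
  Besides merging the gamma factors, Gauss' formula produces \<open>m powr (- m s)\<close>, which cancels
  against the scaling by \<open>m\<close> in the argument of the \<open>G\<close>-function.
\<close>

lemma meijer_integrand_log:
  assumes m: "m \<ge> 1" and s: "Re s > 0"
  shows "of_real (meijer_const m) * meijer_integrand m z ((exp u / real m) ^ m) s
      = Gamma (of_nat m * s) * exp (- (of_nat m * s * of_real u)) * Gamma ((of_nat m * s + z) / of_nat m)"
proof -
  have "Re (of_nat m * s) > 0" using m s by simp
  then have nonpos: "of_nat m * s \<notin> \<int>\<^sub>\<le>\<^sub>0" by (rule Re_pos_not_nonpos_Int)
  have const: "meijer_const m * ((2 * pi) powr ((real m - 1) / 2) * sqrt (real m)) = 1"
  proof -
    have "(2 * pi) powr ((1 - real m) / 2) * (2 * pi) powr ((real m - 1) / 2) = 1"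
      by (simp add: powr_add[symmetric] add_divide_distrib[symmetric])
    then show ?thesis using m by (simp add: meijer_const_def)
  qed
  have ln_power: "ln ((exp u / real m) ^ m) = real m * (u - ln (real m))"
    using m by (simp add: ln_realpow ln_div)
  have "(exp u / real m) ^ m > 0" using m by simp
  then have "of_real ((exp u / real m) ^ m) powr (- s) = exp (- s * of_real (ln ((exp u / real m) ^ m)))"
    using m by (simp add: powr_def Ln_of_real del: of_real_power of_real_divide)
  also have "\<dots> = exp (of_nat m * s * of_real (ln (real m))) * exp (- (of_nat m * s * of_real u))"
    unfolding ln_power by (simp add: exp_add[symmetric] algebra_simps)
  finally have powr: "of_real ((exp u / real m) ^ m) powr (- s)
      = exp (of_nat m * s * of_real (ln (real m))) * exp (- (of_nat m * s * of_real u))" .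
  have "of_real (meijer_const m) * meijer_integrand m z ((exp u / real m) ^ m) s
     = of_real (meijer_const m * ((2 * pi) powr ((real m - 1) / 2) * sqrt (real m)))
        * (exp (- (of_nat m * s * of_real (ln (real m)))) * exp (of_nat m * s * of_real (ln (real m))))
        * (Gamma (of_nat m * s) * exp (- (of_nat m * s * of_real u)) * Gamma (s + z / of_nat m))"
    unfolding meijer_integrand_def Gamma_multiplication[OF m nonpos] powr of_real_mult
    by (simp only: mult_ac)
  also have "exp (- (of_nat m * s * of_real (ln (real m)))) * exp (of_nat m * s * of_real (ln (real m))) = 1"
    by (simp add: exp_minus)
  also have "s + z / of_nat m = (of_nat m * s + z) / of_nat m" using m by (simp add: add_divide_distrib)
  finally show ?thesis unfolding const by simp
qed

text \<open>
  Write the factor \<open>\<Gamma>(s + z / m)\<close> as an integral and interchange; the contour integral that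
  remains is the one in the Cahen-Mellin formula. In particular the value of the \<open>G\<close>-function
  is independent of the abscissa, which may therefore be chosen for each \<open>z\<close> separately.
\<close>

lemma mellin_barnes_kernel:
  assumes m: "m \<ge> 1" and \<mu>: "\<mu> > 0" "\<mu> > - Re z / real m"
  shows "integrable lborel (\<lambda>t. meijer_integrand m z ((exp u / real m) ^ m) (Complex \<mu> t))"
    and "of_real (meijer_const m) * meijer_G \<mu> m z ((exp u / real m) ^ m) = index_kernel m z u"
proof -
  \<comment> \<open>Gauss' formula moves the contour from abscissa \<open>\<mu>\<close> to abscissa \<open>m \<mu>\<close>.\<close>
  define \<sigma> where "\<sigma> = real m * \<mu>"
  have \<sigma>: "\<sigma> > 0" "\<sigma> + Re z > 0" using m \<mu> by (simp_all add: \<sigma>_def field_simps)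
  have s: "of_nat m * Complex \<mu> t = Complex \<sigma> (real m * t)" for t by (simp add: \<sigma>_def complex_eq_iff)
  define J where "J = (\<lambda>t. Gamma (Complex \<sigma> (real m * t)) * exp (- (Complex \<sigma> (real m * t) * of_real u))
      * Gamma ((Complex \<sigma> (real m * t) + z) / of_nat m))"
  have integrand: "of_real (meijer_const m) * meijer_integrand m z ((exp u / real m) ^ m) (Complex \<mu> t) = J t" for t
    unfolding J_def using meijer_integrand_log[OF m, of "Complex \<mu> t"] \<mu> unfolding s by simp
  have Gamma_int: "integrable lborel (\<lambda>t. Gamma (Complex \<sigma> (real m * t)))"
    using lborel_integrable_real_affine[OF integrable_Gamma_vertical[OF \<sigma>(1)], of "real m" 0] m by simp

  define F where "F = (\<lambda>t v. Gamma (Complex \<sigma> (real m * t)) * exp (- (Complex \<sigma> (real m * t) * of_real u))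
      * (of_nat m * exp ((Complex \<sigma> (real m * t) + z) * of_real v - of_real (exp (real m * v)))))"
  have F_int: "integrable (lborel \<Otimes>\<^sub>M lborel) (case_prod F)"
  proof (rule integrable_pair_sheared_product[where \<kappa> = 0 and
        a="\<lambda>t. norm (Gamma (Complex \<sigma> (real m * t))) * exp (- (\<sigma> * u))" and
        b="\<lambda>v. real m * exp ((\<sigma> + Re z) * v - exp (real m * v))"])
    show "case_prod F \<in> borel_measurable (lborel \<Otimes>\<^sub>M lborel)" unfolding F_def by measurable
    show "integrable lborel (\<lambda>t. norm (Gamma (Complex \<sigma> (real m * t))) * exp (- (\<sigma> * u)))"
      using Gamma_int by simp
    show "integrable lborel (\<lambda>v. real m * exp ((\<sigma> + Re z) * v - exp (real m * v)))"
      using exp_log_integral_affine_real(1)[OF \<sigma>(2), of "real m" 0] m by simp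
    show "norm (F x y) \<le> norm (Gamma (Complex \<sigma> (real m * x))) * exp (- (\<sigma> * u)) * (real m * exp ((\<sigma> + Re z) * (y - 0 * x) - exp (real m * (y - 0 * x))))" for x y
      by (simp add: F_def norm_mult)
  qed
  have inner_v: "(\<integral>v. F t v \<partial>lborel) = J t" for t
  proof -
    have "Re (Complex \<sigma> (real m * t) + z) > 0" using \<sigma> by simp
    from exp_log_integral_affine(2)[OF this, of "real m" 0] show ?thesis
      using m by (simp add: F_def J_def)
  qed
  have inner_t: "(\<integral>t. F t v \<partial>lborel) = 2 * pi * exp (z * of_real v - of_real (exp (real m * v)) - of_real (exp (u - v)))" for v
  proof -
    let ?E = "\<lambda>t. Gamma (Complex \<sigma> t) * exp (- (Complex \<sigma> t * of_real (u - v)))"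
    have "F t v = of_nat m * exp (z * of_real v - of_real (exp (real m * v))) * ?E (0 + real m * t)" for t
      by (simp add: F_def exp_add[symmetric] exp_diff[symmetric] algebra_simps)
    then have "(\<integral>t. F t v \<partial>lborel) = of_nat m * exp (z * of_real v - of_real (exp (real m * v))) * (\<integral>t. ?E (0 + real m * t) \<partial>lborel)"
      by (simp only: integral_mult_right_zero)
    also have "of_nat m * exp (z * of_real v - of_real (exp (real m * v))) * (\<integral>t. ?E (0 + real m * t) \<partial>lborel)
        = exp (z * of_real v - of_real (exp (real m * v))) * (\<integral>t. ?E t \<partial>lborel)"
      using m by (subst (2) lborel_integral_real_affine[of "real m" _ 0]) (simp_all add: scaleR_conv_of_real)
    also have "(\<integral>t. ?E t \<partial>lborel) = of_real (2 * pi * exp (- exp (u - v)))" by (rule cahen_mellin[OF \<sigma>(1)])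
    also have "complex_of_real (2 * pi * exp (- exp (u - v))) = 2 * of_real pi * exp (- complex_of_real (exp (u - v)))"
      by (simp flip: exp_of_real)
    also have "exp (z * of_real v - of_real (exp (real m * v))) * (2 * of_real pi * exp (- complex_of_real (exp (u - v))))
        = 2 * of_real pi * (exp (z * of_real v - of_real (exp (real m * v))) * exp (- complex_of_real (exp (u - v))))" by simp
    finally show ?thesis unfolding exp_add[symmetric] by simp
  qed
  have J_int: "integrable lborel J"
    using lborel_pair.integrable_fst'[OF F_int] by (simp add: inner_v)
  have "integrable lborel (\<lambda>t. (1 / of_real (meijer_const m)) * J t)" using J_int by simp
  then show "integrable lborel (\<lambda>t. meijer_integrand m z ((exp u / real m) ^ m) (Complex \<mu> t))"
    unfolding integrand[symmetric] using meijer_const_pos[OF m] by simp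
  then have "of_real (meijer_const m) * meijer_G \<mu> m z ((exp u / real m) ^ m)
      = 1 / (2 * of_real pi) * (\<integral>t. of_real (meijer_const m) * meijer_integrand m z ((exp u / real m) ^ m) (Complex \<mu> t) \<partial>lborel)"
    by (simp add: meijer_G_def line_integral_def integrable_lborel_imp_lebesgue field_simps)
  also have "\<dots> = 1 / (2 * of_real pi) * (\<integral>t. J t \<partial>lborel)" unfolding integrand ..
  also have "(\<integral>t. J t \<partial>lborel) = (\<integral>v. \<integral>t. F t v \<partial>lborel \<partial>lborel)"
    using lborel_pair.Fubini_integral[OF F_int] unfolding inner_v by simp
  also have "\<dots> = (2 * of_real pi) * index_kernel m z u"
    unfolding inner_t index_kernel_def by simp
  finally show "of_real (meijer_const m) * meijer_G \<mu> m z ((exp u / real m) ^ m) = index_kernel m z u" by simp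
qed

text \<open>
  Integrating over \<open>u\<close> first, both integrals are Euler integrals.
\<close>

lemma index_kernel_mellin:
  assumes m: "m \<ge> 1" and a: "Re a > 0" and az: "Re (a + z) > 0"
  shows "integrable lborel (\<lambda>u. exp (a * of_real u) * index_kernel m z u)"
    and "(\<integral>u. exp (a * of_real u) * index_kernel m z u \<partial>lborel) = Gamma a * Gamma ((a + z) / of_nat m) / of_nat m"
proof -
  define F where "F = (\<lambda>v u. exp (a * of_real u) * exp (z * of_real v - of_real (exp (real m * v)) - of_real (exp (u - v))))"
  have F_int: "integrable (lborel \<Otimes>\<^sub>M lborel) (case_prod F)"
  \<comment> \<open>In terms of \<open>u - v\<close> and \<open>v\<close> the modulus of the integrand is a product.\<close>
  proof (rule integrable_pair_sheared_product[where \<kappa> = 1 and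
        a="\<lambda>v. exp (Re (a + z) * v - exp (real m * v))" and b="\<lambda>u. exp (Re a * u - exp u)"])
    show "case_prod F \<in> borel_measurable (lborel \<Otimes>\<^sub>M lborel)" unfolding F_def by measurable
    show "integrable lborel (\<lambda>v. exp (Re (a + z) * v - exp (real m * v)))"
      using exp_log_integral_affine_real(1)[OF az, of "real m" 0] m by simp
    show "integrable lborel (\<lambda>u. exp (Re a * u - exp u))" by (rule Gamma_log_integral_real[OF a])
    show "norm (F x y) \<le> exp (Re (a + z) * x - exp (real m * x)) * exp (Re a * (y - 1 * x) - exp (y - 1 * x))" for x y
      by (simp add: F_def norm_mult exp_add[symmetric] algebra_simps)
  qed
  have inner_u: "(\<integral>u. F v u \<partial>lborel) = Gamma a * exp ((a + z) * of_real v - of_real (exp (real m * v)))" for v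
  proof -
    have "F v u = exp (z * of_real v - of_real (exp (real m * v))) * exp (a * of_real u - of_real (exp (1 * u + - v)))" for u
      by (simp add: F_def exp_add[symmetric] algebra_simps)
    then have "(\<integral>u. F v u \<partial>lborel) = exp (z * of_real v - of_real (exp (real m * v))) * (\<integral>u. exp (a * of_real u - of_real (exp (1 * u + - v))) \<partial>lborel)"
      by (simp only: integral_mult_right_zero)
    also have "\<dots> = exp (z * of_real v - of_real (exp (real m * v))) * (Gamma a * exp (a * of_real v))"
      using exp_log_integral_affine(2)[OF a, of 1 "- v"] by simp
    finally show ?thesis by (simp add: exp_add exp_diff distrib_right)
  qed
  have inner_v: "(\<integral>v. F v u \<partial>lborel) = exp (a * of_real u) * index_kernel m z u" for u
    unfolding F_def index_kernel_def by simp
  show "integrable lborel (\<lambda>u. exp (a * of_real u) * index_kernel m z u)"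
    using lborel_pair.integrable_snd[OF F_int] by (simp only: inner_v)
  have "(\<integral>u. exp (a * of_real u) * index_kernel m z u \<partial>lborel) = (\<integral>v. \<integral>u. F v u \<partial>lborel \<partial>lborel)"
    using lborel_pair.Fubini_integral[OF F_int] unfolding inner_v by simp
  also have "\<dots> = Gamma a * (\<integral>v. exp ((a + z) * of_real v - of_real (exp (real m * v))) \<partial>lborel)"
    unfolding inner_u by simp
  also have "\<dots> = Gamma a * Gamma ((a + z) / of_nat m) / of_nat m"
    using exp_log_integral_affine(2)[OF az, of "real m" 0] m by simp
  finally show "(\<integral>u. exp (a * of_real u) * index_kernel m z u \<partial>lborel) = Gamma a * Gamma ((a + z) / of_nat m) / of_nat m" .
qed

section \<open>The transform as a contour integral\<close>

text \<open>
  The element of the inverse Mellin space represented by \<open>\<phi>\<close> on the line \<open>Re s = c0\<close>, at the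
  point \<open>exp u\<close>.
\<close>

definition log_mellin :: "real \<Rightarrow> (real \<Rightarrow> complex) \<Rightarrow> real \<Rightarrow> complex" where
  "log_mellin c0 \<phi> u = 1 / (2 * of_real pi) * (\<integral>t. \<phi> t * exp (- (Complex c0 t * of_real u)) \<partial>lborel)"

definition gamma_transform :: "real \<Rightarrow> nat \<Rightarrow> (real \<Rightarrow> complex) \<Rightarrow> complex \<Rightarrow> complex" where
  "gamma_transform c0 m \<phi> z = 1 / (2 * of_real pi * of_nat m) *
     (\<integral>t. Gamma ((1 - Complex c0 t + z) / of_nat m) * Gamma (1 - Complex c0 t) * \<phi> t \<partial>lborel)"

lemma mellin_rep_log:
  assumes "mellin_rep c0 f fs"
  obtains \<phi> where "integrable lborel \<phi>" "AE t in lebesgue. fs (Complex c0 t) = \<phi> t"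
    "\<And>u. f (exp u) = log_mellin c0 \<phi> u"
    "line_norm c0 fs = (\<integral>t. norm (\<phi> t) \<partial>lborel)"
proof -
  have fs: "integrable lebesgue (\<lambda>t. fs (Complex c0 t))" using assms by (simp add: mellin_rep_def line_L1_def)
  obtain \<phi> where \<phi>: "integrable lborel \<phi>" and AE: "AE t in lebesgue. fs (Complex c0 t) = \<phi> t"
    using integrable_lebesgue_AE_lborel[OF fs] by blast
  have [measurable]: "\<phi> \<in> borel_measurable borel" using \<phi> by (simp add: borel_measurable_integrable)
  have [measurable]: "(\<lambda>t. fs (Complex c0 t)) \<in> borel_measurable lebesgue" using fs by (rule borel_measurable_integrable)
  have "f (exp u) = log_mellin c0 \<phi> u" for u
  proof -
    have meas: "(\<lambda>t. \<phi> t * exp (- (Complex c0 t * of_real u))) \<in> borel_measurable borel" by measurable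
    have meas': "(\<lambda>t. exp (- (Complex c0 t * of_real u))) \<in> borel_measurable lebesgue" 
      by (intro measurable_completion) measurable
    have "f (exp u) = 1 / (2 * of_real pi) * (\<integral>t. fs (Complex c0 t) * exp (- (Complex c0 t * of_real u)) \<partial>lebesgue)"
      using assms by (simp add: mellin_rep_def line_integral_def powr_def exp_of_real[symmetric])
    also have "(\<integral>t. fs (Complex c0 t) * exp (- (Complex c0 t * of_real u)) \<partial>lebesgue)
        = (\<integral>t. \<phi> t * exp (- (Complex c0 t * of_real u)) \<partial>lebesgue)"
      using AE meas meas' by (intro integral_cong_AE) (auto intro: measurable_completion elim: AE_mp)
    also have "\<dots> = (\<integral>t. \<phi> t * exp (- (Complex c0 t * of_real u)) \<partial>lborel)"
      using meas by (intro integral_completion) simp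
    finally show ?thesis by (simp add: log_mellin_def)
  qed
  moreover have "line_norm c0 fs = (\<integral>t. norm (\<phi> t) \<partial>lborel)"
  proof -
    have "line_norm c0 fs = (\<integral>t. norm (\<phi> t) \<partial>lebesgue)" unfolding line_norm_def
      using AE by (intro integral_cong_AE) (auto intro!: measurable_completion elim: AE_mp)
    also have "\<dots> = (\<integral>t. norm (\<phi> t) \<partial>lborel)" by (intro integral_completion) simp
    finally show ?thesis .
  qed
  ultimately show ?thesis using that \<phi> AE by blast
qed

lemma kernel_integral_eq_gamma_transform:
  assumes m: "m \<ge> 1" and c0: "c0 < 1" and z: "Re z > c0 - 1" and \<phi>: "integrable lborel \<phi>"
  shows "integrable lborel (\<lambda>u. exp u *\<^sub>R (index_kernel m z u * log_mellin c0 \<phi> u))"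
    and "(\<integral>u. exp u *\<^sub>R (index_kernel m z u * log_mellin c0 \<phi> u) \<partial>lborel) = gamma_transform c0 m \<phi> z"
proof -
  have [measurable]: "\<phi> \<in> borel_measurable borel" using \<phi> by (simp add: borel_measurable_integrable)
  have a: "Re (1 - Complex c0 t) > 0" and az: "Re (1 - Complex c0 t + z) > 0" for t
    using c0 z by simp_all
  have [measurable]: "index_kernel m z \<in> borel_measurable borel"
    unfolding index_kernel_def by measurable
  define F where "F = (\<lambda>t u. \<phi> t * (exp ((1 - Complex c0 t) * of_real u) * index_kernel m z u))"
  have F_int: "integrable (lborel \<Otimes>\<^sub>M lborel) (case_prod F)"
  proof (rule integrable_pair_sheared_product[where \<kappa> = 0 and a="\<lambda>t. norm (\<phi> t)" and
        b="\<lambda>u. norm (exp ((1 - Complex c0 0) * of_real u) * index_kernel m z u)"])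
    show "case_prod F \<in> borel_measurable (lborel \<Otimes>\<^sub>M lborel)" unfolding F_def by measurable
    show "integrable lborel (\<lambda>u. norm (exp ((1 - Complex c0 0) * of_real u) * index_kernel m z u))"
      by (intro integrable_norm index_kernel_mellin m a az)
    show "norm (F x y) \<le> norm (\<phi> x) * norm (exp ((1 - Complex c0 0) * of_real (y - 0 * x)) * index_kernel m z (y - 0 * x))" for x y
      by (simp add: F_def norm_mult)
  qed (use \<phi> in simp)
  have inner_u: "(\<integral>u. F t u \<partial>lborel) = 1 / of_nat m * (Gamma ((1 - Complex c0 t + z) / of_nat m) * Gamma (1 - Complex c0 t) * \<phi> t)" for t
    unfolding F_def using index_kernel_mellin(2)[OF m a az, of t] by (simp add: mult_ac)
  have inner_t: "(\<integral>t. F t u \<partial>lborel) = 2 * of_real pi * (exp u *\<^sub>R (index_kernel m z u * log_mellin c0 \<phi> u))" for u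
  proof -
    have "F t u = (exp (of_real u) * index_kernel m z u) * (\<phi> t * exp (- (Complex c0 t * of_real u)))" for t
      by (simp add: F_def exp_diff exp_minus left_diff_distrib field_simps)
    then have "(\<integral>t. F t u \<partial>lborel) = (exp (of_real u) * index_kernel m z u) * (\<integral>t. \<phi> t * exp (- (Complex c0 t * of_real u)) \<partial>lborel)"
      by (simp only: integral_mult_right_zero)
    then show ?thesis by (simp add: log_mellin_def scaleR_conv_of_real exp_of_real[symmetric])
  qed
  have "integrable lborel (\<lambda>u. 1 / (2 * of_real pi) * (2 * of_real pi * (exp u *\<^sub>R (index_kernel m z u * log_mellin c0 \<phi> u))))"
    using lborel_pair.integrable_snd[OF F_int] unfolding inner_t by (rule integrable_mult_right)
  then show "integrable lborel (\<lambda>u. exp u *\<^sub>R (index_kernel m z u * log_mellin c0 \<phi> u))" by simp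
  have "2 * of_real pi * (\<integral>u. exp u *\<^sub>R (index_kernel m z u * log_mellin c0 \<phi> u) \<partial>lborel) = (\<integral>u. 2 * of_real pi * (exp u *\<^sub>R (index_kernel m z u * log_mellin c0 \<phi> u)) \<partial>lborel)"
    by (rule integral_mult_right_zero[symmetric])
  also have "\<dots> = (\<integral>t. 1 / of_nat m * (Gamma ((1 - Complex c0 t + z) / of_nat m) * Gamma (1 - Complex c0 t) * \<phi> t) \<partial>lborel)"
    using lborel_pair.Fubini_integral[OF F_int] unfolding inner_t inner_u .
  also have "\<dots> = 2 * of_real pi * gamma_transform c0 m \<phi> z"
    unfolding gamma_transform_def integral_mult_right_zero using m by simp
  finally show "(\<integral>u. exp u *\<^sub>R (index_kernel m z u * log_mellin c0 \<phi> u) \<partial>lborel) = gamma_transform c0 m \<phi> z"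
    by simp
qed

lemma index_transform_eq_gamma_transform:
  assumes m: "m \<ge> 1" and c0: "c0 < 1" and z: "Re z > c0 - 1" and \<mu>: "\<mu> z > max 0 (- Re z / real m)"
    and \<phi>: "integrable lborel \<phi>" and f: "\<And>u. f (exp u) = log_mellin c0 \<phi> u"
  shows "set_integrable lebesgue {0<..} (\<lambda>x. meijer_G (\<mu> z) m z ((x / real m) ^ m) * f x)"
    and "index_transform \<mu> m f z = gamma_transform c0 m \<phi> z"
proof -
  have C: "meijer_const m > 0" using m by (rule meijer_const_pos)
  define g where "g x = meijer_G (\<mu> z) m z ((x / real m) ^ m) * f x" for x
  have g: "exp u *\<^sub>R g (exp u) = 1 / of_real (meijer_const m) * (exp u *\<^sub>R (index_kernel m z u * log_mellin c0 \<phi> u))" for u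
  proof -
    have "index_kernel m z u = of_real (meijer_const m) * meijer_G (\<mu> z) m z ((exp u / real m) ^ m)"
      using mellin_barnes_kernel(2)[OF m, of "\<mu> z" z u] \<mu> by simp
    then show ?thesis using C by (simp add: g_def f)
  qed
  note K = kernel_integral_eq_gamma_transform[OF m c0 z \<phi>]
  have int: "integrable lborel (\<lambda>u. exp u *\<^sub>R g (exp u))" unfolding g using K(1) by (rule integrable_mult_right)
  note int' = integrable_lborel_imp_lebesgue[OF int]
  show "set_integrable lebesgue {0<..} (\<lambda>x. meijer_G (\<mu> z) m z ((x / real m) ^ m) * f x)"
    using int'(1) unfolding g_def[symmetric] set_integrable_exp_substitution .
  have "index_transform \<mu> m f z = of_real (meijer_const m) * (LINT x:{0<..}|lebesgue. g x)"
    by (simp add: index_transform_def meijer_const_def g_def)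
  also have "(LINT x:{0<..}|lebesgue. g x) = (\<integral>u. exp u *\<^sub>R g (exp u) \<partial>lborel)"
    using set_integral_exp_substitution[OF int'(1)] int'(2) by simp
  also have "\<dots> = 1 / of_real (meijer_const m) * gamma_transform c0 m \<phi> z"
    unfolding g integral_mult_right_zero K(2) ..
  finally show "index_transform \<mu> m f z = gamma_transform c0 m \<phi> z" using C by simp
qed

section \<open>Analyticity and boundedness\<close>

text \<open>
  On a small disc around \<open>z\<close> the argument of \<open>\<Gamma>((1 - s + z) / m)\<close> has its real part in a
  compact subset of the positive half-line, which bounds this factor uniformly in \<open>s\<close>.
\<close>

lemma gamma_transform_holomorphic:
  assumes m: "m \<ge> 1" and c0: "c0 < 1" and \<phi>: "integrable lborel \<phi>"
  shows "gamma_transform c0 m \<phi> holomorphic_on {z. Re z > c0 - 1}"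
proof -
  have [measurable]: "\<phi> \<in> borel_measurable borel" using \<phi> by (simp add: borel_measurable_integrable)
  let ?\<Phi> = "\<lambda>t z. Gamma ((1 - Complex c0 t + z) / of_nat m) * Gamma (1 - Complex c0 t) * \<phi> t"
  have open_half: "open {z. Re z > a}" for a by (rule open_halfspace_Re_gt)
  have "\<exists>r>0. gamma_transform c0 m \<phi> holomorphic_on ball z0 r" if z0: "Re z0 > c0 - 1" for z0
  proof -
    \<comment> \<open>Half the distance of \<open>z0\<close> from the boundary of the half-plane.\<close>
    define r where "r = (Re z0 - (c0 - 1)) / 2"
    have r: "r > 0" using z0 by (simp add: r_def)
    have near: "\<bar>Re z - Re z0\<bar> < r" if "z \<in> ball z0 r" for z
      using that abs_Re_le_cmod[of "z - z0"] by (simp add: dist_norm norm_minus_commute)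
    define I where "I = {r / real m .. (1 - c0 + Re z0 + r) / real m}"
    have "continuous_on I (Gamma :: real \<Rightarrow> real)"
    proof (rule continuous_on_Gamma)
      have "x > 0" if "x \<in> I" for x
        using that r m by (auto simp: I_def intro: less_le_trans[of 0 "r / real m"])
      then show "I \<inter> \<int>\<^sub>\<le>\<^sub>0 = {}" by (force elim!: nonpos_Ints_cases)
    qed
    then have "compact (Gamma ` I)" unfolding I_def by (intro compact_continuous_image) auto
    then have "bounded (Gamma ` I)" by (rule compact_imp_bounded)
    then obtain B where B: "\<And>x. x \<in> I \<Longrightarrow> \<bar>Gamma x\<bar> \<le> B" by (auto simp: bounded_iff)
    have arg: "Re ((1 - Complex c0 t + z) / of_nat m) \<in> I" "Re ((1 - Complex c0 t + z) / of_nat m) > 0" if "z \<in> ball z0 r" for t z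
    proof -
      have "Re ((1 - Complex c0 t + z) / of_nat m) = (1 - c0 + Re z) / real m" by simp
      moreover have "r < 1 - c0 + Re z"
      proof -
        have "Re z0 - Re z < r" using near[OF that] by linarith
        moreover have "2 * r = Re z0 - (c0 - 1)" by (simp add: r_def)
        ultimately show ?thesis by linarith
      qed
      moreover have "1 - c0 + Re z \<le> 1 - c0 + Re z0 + r"
        using near[OF that] by linarith
      ultimately show "Re ((1 - Complex c0 t + z) / of_nat m) \<in> I" "Re ((1 - Complex c0 t + z) / of_nat m) > 0"
        using m r by (auto simp: I_def divide_right_mono)
    qed
    have "(\<lambda>z. \<integral>t. ?\<Phi> t z \<partial>lborel) holomorphic_on ball z0 r"
    proof (rule holomorphic_on_parametric_integral[where B="\<lambda>t. B * Gamma (1 - c0) * norm (\<phi> t)"])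
      show "?\<Phi> t holomorphic_on ball z0 r" for t
        by (intro holomorphic_intros) (use arg(2) m in \<open>auto intro!: Re_pos_not_nonpos_Int simp del: Re_divide_of_nat\<close>)
      show "integrable lborel (\<lambda>t. B * Gamma (1 - c0) * norm (\<phi> t))" using \<phi> by simp
      show "norm (?\<Phi> t z) \<le> B * Gamma (1 - c0) * norm (\<phi> t)" if "z \<in> ball z0 r" for t z
      proof -
        have "norm (Gamma ((1 - Complex c0 t + z) / of_nat m)) \<le> Gamma (Re ((1 - Complex c0 t + z) / of_nat m))"
          by (rule norm_Gamma_le_Gamma_Re) (rule arg(2)[OF that])
        also have "\<dots> \<le> B" using B[OF arg(1)[OF that, of t]] by linarith
        finally have 1: "norm (Gamma ((1 - Complex c0 t + z) / of_nat m)) \<le> B" .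
        have 2: "norm (Gamma (1 - Complex c0 t)) \<le> Gamma (1 - c0)"
          using norm_Gamma_le_Gamma_Re[of "1 - Complex c0 t"] c0 by simp
        show ?thesis unfolding norm_mult
          using 1 2 order.trans[OF norm_ge_zero 1] by (intro mult_right_mono mult_mono) auto
      qed
    qed (simp, measurable)
    then have "gamma_transform c0 m \<phi> holomorphic_on ball z0 r"
      unfolding gamma_transform_def[abs_def] by (intro holomorphic_intros)
    then show ?thesis using r by blast
  qed
  then have "gamma_transform c0 m \<phi> analytic_on {z. Re z > c0 - 1}"
    by (auto simp: analytic_on_def)
  then show ?thesis by (rule analytic_imp_holomorphic)
qed

definition gamma_line_mass :: "real \<Rightarrow> nat \<Rightarrow> real" where
  "gamma_line_mass \<sigma> m = (\<integral>\<tau>. norm (Gamma (Complex \<sigma> \<tau> / of_nat m)) \<partial>lborel)"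

lemma integrable_Gamma_scaled_vertical:
  assumes m: "m \<ge> 1" and \<sigma>: "\<sigma> > 0"
  shows "integrable lborel (\<lambda>\<tau>. Gamma (Complex \<sigma> \<tau> / of_nat m))"
proof -
  have "integrable lborel (\<lambda>\<tau>. Gamma (Complex (\<sigma> / real m) (0 + 1 / real m * \<tau>)))"
    using m \<sigma> by (intro lborel_integrable_real_affine integrable_Gamma_vertical) auto
  moreover have "Complex (\<sigma> / real m) (0 + 1 / real m * \<tau>) = Complex \<sigma> \<tau> / of_nat m" for \<tau>
    by (simp add: complex_eq_iff)
  ultimately show ?thesis by simp
qed

lemma gamma_line_mass_nonneg: "gamma_line_mass \<sigma> m \<ge> 0"
  by (simp add: gamma_line_mass_def)

definition gamma_integrand :: "real \<Rightarrow> nat \<Rightarrow> (real \<Rightarrow> complex) \<Rightarrow> real \<Rightarrow> real \<Rightarrow> real \<Rightarrow> complex" where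
  "gamma_integrand c0 m \<phi> \<gamma> t \<tau> = Gamma ((1 - Complex c0 t + Complex \<gamma> \<tau>) / of_nat m) * Gamma (1 - Complex c0 t) * \<phi> t"

lemma gamma_transform_line:
  "gamma_transform c0 m \<phi> (Complex \<gamma> \<tau>) = 1 / (2 * of_real pi * of_nat m) * (\<integral>t. gamma_integrand c0 m \<phi> \<gamma> t \<tau> \<partial>lborel)"
  by (simp add: gamma_transform_def gamma_integrand_def)

lemma gamma_integrand_bounds:
  assumes m: "m \<ge> 1" and c0: "c0 < 1" and \<gamma>: "\<gamma> > c0 - 1" and \<phi>: "integrable lborel \<phi>"
  shows "case_prod (gamma_integrand c0 m \<phi> \<gamma>) \<in> borel_measurable (lborel \<Otimes>\<^sub>M lborel)"
    and "integrable lborel (\<lambda>t. Gamma (1 - c0) * norm (\<phi> t))"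
    and "integrable lborel (\<lambda>\<tau>. norm (Gamma (Complex (1 - c0 + \<gamma>) \<tau> / of_nat m)))"
    and "norm (gamma_integrand c0 m \<phi> \<gamma> t \<tau>) \<le> Gamma (1 - c0) * norm (\<phi> t) * norm (Gamma (Complex (1 - c0 + \<gamma>) (\<tau> - 1 * t) / of_nat m))"
proof -
  have [measurable]: "\<phi> \<in> borel_measurable borel" using \<phi> by (simp add: borel_measurable_integrable)
  show "case_prod (gamma_integrand c0 m \<phi> \<gamma>) \<in> borel_measurable (lborel \<Otimes>\<^sub>M lborel)"
    unfolding gamma_integrand_def by measurable
  show "integrable lborel (\<lambda>t. Gamma (1 - c0) * norm (\<phi> t))" using \<phi> by simp
  show "integrable lborel (\<lambda>\<tau>. norm (Gamma (Complex (1 - c0 + \<gamma>) \<tau> / of_nat m)))"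
    using m \<gamma> by (intro integrable_norm integrable_Gamma_scaled_vertical) auto
  have "norm (Gamma (1 - Complex c0 t)) \<le> Gamma (1 - c0)"
    using norm_Gamma_le_Gamma_Re[of "1 - Complex c0 t"] c0 by simp
  moreover have "1 - Complex c0 t + Complex \<gamma> \<tau> = Complex (1 - c0 + \<gamma>) (\<tau> - 1 * t)"
    by (simp add: complex_eq_iff)
  ultimately show "norm (gamma_integrand c0 m \<phi> \<gamma> t \<tau>) \<le> Gamma (1 - c0) * norm (\<phi> t) * norm (Gamma (Complex (1 - c0 + \<gamma>) (\<tau> - 1 * t) / of_nat m))"
    by (simp add: gamma_integrand_def norm_mult mult_ac mult_left_mono mult_right_mono)
qed

text \<open>
  The factor \<open>1 / m\<close> in front of the contour integral is at most 1 and is dropped from the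
  bound.
\<close>

lemma gamma_transform_vertical_L1:
  assumes m: "m \<ge> 1" and c0: "c0 < 1" and \<gamma>: "\<gamma> > c0 - 1" and \<phi>: "integrable lborel \<phi>"
  shows "integrable lborel (\<lambda>\<tau>. gamma_transform c0 m \<phi> (Complex \<gamma> \<tau>))"
    and "(\<integral>\<tau>. norm (gamma_transform c0 m \<phi> (Complex \<gamma> \<tau>)) \<partial>lborel)
      \<le> Gamma (1 - c0) * gamma_line_mass (1 - c0 + \<gamma>) m * (1 / (2 * pi) * (\<integral>t. norm (\<phi> t) \<partial>lborel))"
proof -
  note bounds = gamma_integrand_bounds[OF m c0 \<gamma> \<phi>]
  show "integrable lborel (\<lambda>\<tau>. gamma_transform c0 m \<phi> (Complex \<gamma> \<tau>))"
    unfolding gamma_transform_line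
    using lborel_pair.integrable_snd[OF integrable_pair_sheared_product[OF bounds]] by simp
  have "(\<integral>\<tau>. norm (gamma_transform c0 m \<phi> (Complex \<gamma> \<tau>)) \<partial>lborel)
      = 1 / (2 * pi * real m) * (\<integral>\<tau>. norm (\<integral>t. gamma_integrand c0 m \<phi> \<gamma> t \<tau> \<partial>lborel) \<partial>lborel)"
    unfolding gamma_transform_line norm_mult by (simp add: norm_divide norm_mult)
  also have "\<dots> \<le> 1 / (2 * pi * real m) * (Gamma (1 - c0) * (\<integral>t. norm (\<phi> t) \<partial>lborel) * gamma_line_mass (1 - c0 + \<gamma>) m)"
    using norm_integral_sheared_product_le[OF bounds]
    by (intro mult_left_mono) (simp_all add: gamma_line_mass_def)
  also have "\<dots> \<le> 1 / (2 * pi) * (Gamma (1 - c0) * (\<integral>t. norm (\<phi> t) \<partial>lborel) * gamma_line_mass (1 - c0 + \<gamma>) m)"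
    using m c0 by (intro mult_right_mono mult_nonneg_nonneg gamma_line_mass_nonneg divide_left_mono) auto
  finally show "(\<integral>\<tau>. norm (gamma_transform c0 m \<phi> (Complex \<gamma> \<tau>)) \<partial>lborel)
      \<le> Gamma (1 - c0) * gamma_line_mass (1 - c0 + \<gamma>) m * (1 / (2 * pi) * (\<integral>t. norm (\<phi> t) \<partial>lborel))"
    by (simp add: mult_ac)
qed

lemma index_transform_bounded_operator:
  assumes m: "m \<ge> 1" and c0: "c0 < 1" and \<mu>: "\<And>z. \<mu> z > max 0 (- Re z / real m)" and \<gamma>: "\<gamma> > c0 - 1"
  defines "K \<equiv> Gamma (1 - c0) * gamma_line_mass (1 - c0 + \<gamma>) m"
  shows "bounded_operator c0 \<gamma> (index_transform \<mu> m)"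
    and "operator_norm c0 \<gamma> (index_transform \<mu> m) \<le> K"
proof -
  have K: "K \<ge> 0" using c0 by (simp add: K_def gamma_line_mass_nonneg)
  have main: "index_transform \<mu> m f \<in> line_L1 \<gamma> \<and>
      line_norm \<gamma> (index_transform \<mu> m f) \<le> K * inv_mellin_norm c0 f \<and>
      (\<forall>z. Re z = \<gamma> \<longrightarrow> set_integrable lebesgue {0<..} (\<lambda>x. meijer_G (\<mu> z) m z ((x / real m) ^ m) * f x))"
    if f: "f \<in> inv_mellin_space c0" for f
  proof -
    define fs where "fs = (SOME fs. mellin_rep c0 f fs)"
    have "mellin_rep c0 f fs" unfolding fs_def using f by (intro someI_ex[of "mellin_rep c0 f"]) (simp add: inv_mellin_space_def)
    then obtain \<phi> where \<phi>: "integrable lborel \<phi>" and f_log: "\<And>u. f (exp u) = log_mellin c0 \<phi> u"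
      and norm_fs: "line_norm c0 fs = (\<integral>t. norm (\<phi> t) \<partial>lborel)" by (rule mellin_rep_log) blast
    have transform: "set_integrable lebesgue {0<..} (\<lambda>x. meijer_G (\<mu> z) m z ((x / real m) ^ m) * f x)"
        "index_transform \<mu> m f z = gamma_transform c0 m \<phi> z" if "Re z > c0 - 1" for z
      using index_transform_eq_gamma_transform[of m c0 z \<mu> \<phi> f] m c0 that \<mu> \<phi> f_log by blast+
    have eq: "index_transform \<mu> m f (Complex \<gamma> \<tau>) = gamma_transform c0 m \<phi> (Complex \<gamma> \<tau>)" for \<tau>
      using \<gamma> by (intro transform(2)) simp
    note L1 = gamma_transform_vertical_L1[OF m c0 \<gamma> \<phi>]
    have "index_transform \<mu> m f \<in> line_L1 \<gamma>"
      unfolding line_L1_def eq mem_Collect_eq by (rule integrable_lborel_imp_lebesgue(1)[OF L1(1)])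
    moreover have "line_norm \<gamma> (index_transform \<mu> m f) \<le> K * inv_mellin_norm c0 f"
    proof -
      have "line_norm \<gamma> (index_transform \<mu> m f) = (\<integral>\<tau>. norm (gamma_transform c0 m \<phi> (Complex \<gamma> \<tau>)) \<partial>lborel)"
        unfolding line_norm_def eq
        by (rule integral_completion) (use borel_measurable_integrable[OF L1(1)] in simp)
      also have "\<dots> \<le> K * inv_mellin_norm c0 f"
        using L1(2) by (simp add: K_def inv_mellin_norm_def fs_def[symmetric] norm_fs)
      finally show ?thesis .
    qed
    ultimately show ?thesis using transform(1) \<gamma> by auto
  qed
  have linear: "index_transform \<mu> m (\<lambda>x. a * f x + b * g x) z = a * index_transform \<mu> m f z + b * index_transform \<mu> m g z"
    if "f \<in> inv_mellin_space c0" "g \<in> inv_mellin_space c0" "Re z = \<gamma>" for f g a b z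
  proof -
    let ?G = "\<lambda>x. meijer_G (\<mu> z) m z ((x / real m) ^ m)"
    have f: "set_integrable lebesgue {0<..} (\<lambda>x. ?G x * f x)" and g: "set_integrable lebesgue {0<..} (\<lambda>x. ?G x * g x)"
      using main that by blast+
    have "(LINT x:{0<..}|lebesgue. ?G x * (a * f x + b * g x)) = (LINT x:{0<..}|lebesgue. a * (?G x * f x) + b * (?G x * g x))"
      by (simp add: algebra_simps)
    also have "\<dots> = a * (LINT x:{0<..}|lebesgue. ?G x * f x) + b * (LINT x:{0<..}|lebesgue. ?G x * g x)"
      using f g by (subst set_integral_add(2)) auto
    finally show ?thesis unfolding index_transform_def by (simp add: algebra_simps)
  qed
  show "bounded_operator c0 \<gamma> (index_transform \<mu> m)"
    unfolding bounded_operator_def using main linear by blast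
  show "operator_norm c0 \<gamma> (index_transform \<mu> m) \<le> K"
    unfolding operator_norm_def by (rule cInf_lower) (use K main in \<open>auto intro: bdd_belowI\<close>)
qed

section \<open>The inversion kernel and its Laplace transform\<close>

text \<open>
  Restrict Euler's integral to \<open>0 \<le> u \<le> 1\<close>. The bound makes the reciprocal gamma factors in
  the series for \<open>S_hat\<close> harmless for convergence.
\<close>

lemma Gamma_lower_bound:
  assumes "a > 0" shows "exp (- exp 1) \<le> Gamma (a :: real)"
proof -
  have "exp (- exp 1) = (\<integral>u. indicator {0..1::real} u * exp (- exp 1) \<partial>lborel :: real)"
    by simp
  also have "\<dots> \<le> (\<integral>u. exp (a * u - exp u) \<partial>lborel)"
  proof (rule integral_mono)
    show "indicator {0..1} u * exp (- exp 1) \<le> exp (a * u - exp u)" for u :: real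
    proof (cases "u \<in> {0..1}")
      case True
      then have "0 \<le> a * u" "exp u \<le> exp 1" using assms by auto
      then have "- exp 1 \<le> a * u - exp u" by linarith
      then show ?thesis using True by simp
    qed simp
  qed (use Gamma_log_integral_real(1)[OF assms] in auto)
  finally show ?thesis using Gamma_log_integral_real(2)[OF assms] by simp
qed

text \<open>
  By the functional equation the quotient \<open>\<Gamma>(w + N) / \<Gamma>(w)\<close> is the product of the \<open>w + i\<close>, and
  each factor is at least its real part in modulus.
\<close>

lemma norm_Gamma_shift:
  assumes w: "Re w > 0"
  shows "norm (Gamma w) * Gamma (Re w + real N) \<le> Gamma (Re w) * norm (Gamma (w + of_nat N))"
proof -
  have nz: "Gamma w \<noteq> 0" using w by (simp add: Gamma_eq_zero_iff Re_pos_not_nonpos_Int)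
  have "pochhammer (Re w) N \<le> norm (pochhammer w N)"
  proof -
    have "(\<Prod>i\<in>{0..<N}. Re w + real i) \<le> (\<Prod>i\<in>{0..<N}. norm (w + of_nat i))"
      using w complex_Re_le_cmod[of "w + of_nat i" for i] by (intro prod_mono) auto
    then show ?thesis by (simp add: pochhammer_prod prod_norm)
  qed
  moreover have "pochhammer (Re w) N = Gamma (Re w + real N) / Gamma (Re w)"
    using w by (intro pochhammer_Gamma) (auto elim!: nonpos_Ints_cases)
  moreover have "pochhammer w N = Gamma (w + of_nat N) / Gamma w"
    using w by (intro pochhammer_Gamma Re_pos_not_nonpos_Int)
  ultimately have "Gamma (Re w + real N) / Gamma (Re w) \<le> norm (Gamma (w + of_nat N)) / norm (Gamma w)"
    by (simp add: norm_divide)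
  then show ?thesis using w nz by (simp add: field_simps)
qed

lemma of_nat_minus_neg_pos: "\<gamma> < 0 \<Longrightarrow> real N - \<gamma> > 0"
  using of_nat_0_le_iff[of N, where 'a=real] by linarith

lemma Re_of_nat_minus_neg_pos: "Re z < 0 \<Longrightarrow> Re (of_nat N - z) > 0"
  using of_nat_minus_neg_pos[of "Re z" N] by simp

definition S_term :: "nat \<Rightarrow> complex \<Rightarrow> nat \<Rightarrow> real \<Rightarrow> complex" where
  "S_term m z n u = exp ((of_nat (m * n) - z - 1) * of_real u) / (fact n * Gamma (of_nat (m * n) - z))"

text \<open>
  The term of the series at the real point \<open>\<gamma>\<close>.
\<close>

definition S_majorant :: "nat \<Rightarrow> real \<Rightarrow> nat \<Rightarrow> real \<Rightarrow> real" where
  "S_majorant m \<gamma> n u = exp ((real (m * n) - \<gamma> - 1) * u) / (fact n * Gamma (real (m * n) - \<gamma>))"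

lemma S_hat_exp: "S_hat m z (exp u) = (\<Sum>n. S_term m z n u)"
  unfolding S_hat_def S_term_def by (simp add: powr_def exp_of_real[symmetric])

lemma S_majorant_pos: "\<gamma> < 0 \<Longrightarrow> S_majorant m \<gamma> n u > 0"
  unfolding S_majorant_def by (intro divide_pos_pos mult_pos_pos Gamma_real_pos of_nat_minus_neg_pos) simp_all

text \<open>
  The dependence on the imaginary part of \<open>z\<close> is confined to the factor \<open>1 / |\<Gamma>(- z)|\<close>, which
  is common to all terms. This separation of variables is what the interchange of integrals in
  the inversion formula rests on.
\<close>

lemma norm_S_term_le:
  assumes z: "Re z < 0"
  shows "norm (S_term m z n u) \<le> Gamma (- Re z) / norm (Gamma (- z)) * S_majorant m (Re z) n u"
proof -
  let ?N = "m * n"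
  have nz: "Gamma (- z) \<noteq> 0" "Gamma (of_nat ?N - z) \<noteq> 0"
    using Re_pos_not_nonpos_Int[of "- z"] Re_pos_not_nonpos_Int[OF Re_of_nat_minus_neg_pos[OF z, of ?N]] z
    by (auto simp: Gamma_eq_zero_iff)
  have G: "Gamma (real ?N - Re z) > 0" by (intro Gamma_real_pos of_nat_minus_neg_pos z)
  have "norm (Gamma (- z)) * Gamma (real ?N - Re z) \<le> Gamma (- Re z) * norm (Gamma (of_nat ?N - z))"
    using norm_Gamma_shift[of "- z" ?N] z by simp
  then have "1 / norm (Gamma (of_nat ?N - z)) \<le> Gamma (- Re z) / norm (Gamma (- z)) * (1 / Gamma (real ?N - Re z))"
    using nz G by (simp add: field_simps)
  then have "exp ((real ?N - Re z - 1) * u) / fact n * (1 / norm (Gamma (of_nat ?N - z)))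
      \<le> exp ((real ?N - Re z - 1) * u) / fact n * (Gamma (- Re z) / norm (Gamma (- z)) * (1 / Gamma (real ?N - Re z)))"
    by (intro mult_left_mono) auto
  then show ?thesis
    by (simp add: S_term_def S_majorant_def norm_divide norm_mult mult_ac)
qed

lemma S_majorant_le:
  assumes \<gamma>: "\<gamma> < 0"
  shows "S_majorant m \<gamma> n u \<le> exp ((- \<gamma> - 1) * u) * exp (exp 1) * (exp (real m * u) ^ n / fact n)"
proof -
  have pos: "real (m * n) - \<gamma> > 0" by (rule of_nat_minus_neg_pos[OF \<gamma>])
  have "1 / Gamma (real (m * n) - \<gamma>) \<le> 1 / exp (- exp 1)"
    using Gamma_lower_bound[OF pos] Gamma_real_pos[OF pos] by (intro divide_left_mono mult_pos_pos) auto
  also have "1 / exp (- exp (1::real)) = exp (exp 1)" by (simp add: exp_minus field_simps)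
  finally have *: "1 / Gamma (real (m * n) - \<gamma>) \<le> exp (exp 1)" .
  have e: "exp ((real (m * n) - \<gamma> - 1) * u) = exp ((- \<gamma> - 1) * u) * exp (real m * u) ^ n"
    by (simp add: exp_of_nat_mult[symmetric] exp_add[symmetric] algebra_simps)
  have "S_majorant m \<gamma> n u = exp ((- \<gamma> - 1) * u) * (exp (real m * u) ^ n / fact n) * (1 / Gamma (real (m * n) - \<gamma>))"
    unfolding S_majorant_def e by simp
  also have "\<dots> \<le> exp ((- \<gamma> - 1) * u) * (exp (real m * u) ^ n / fact n) * exp (exp 1)"
    using * by (intro mult_left_mono) auto
  finally show ?thesis by (simp add: mult_ac)
qed

lemma summable_S_majorant: "\<gamma> < 0 \<Longrightarrow> summable (\<lambda>n. S_majorant m \<gamma> n u)"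
proof (rule summable_comparison_test')
  show "summable (\<lambda>n. exp ((- \<gamma> - 1) * u) * exp (exp 1) * (exp (real m * u) ^ n / fact n))"
    using summable_exp[of "exp (real m * u)"] by (intro summable_mult) (simp add: field_simps)
qed (use S_majorant_le S_majorant_pos in \<open>auto simp: less_imp_le\<close>)

definition S_bound :: "nat \<Rightarrow> real \<Rightarrow> real \<Rightarrow> real" where
  "S_bound m \<gamma> u = (\<Sum>n. S_majorant m \<gamma> n u)"

lemma S_bound_le:
  assumes "\<gamma> < 0"
  shows "S_bound m \<gamma> u \<le> exp ((- \<gamma> - 1) * u) * exp (exp 1) * exp (exp (real m * u))"
proof -
  have sums: "(\<lambda>n. exp ((- \<gamma> - 1) * u) * exp (exp 1) * (exp (real m * u) ^ n / fact n))
     sums (exp ((- \<gamma> - 1) * u) * exp (exp 1) * exp (exp (real m * u)))"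
    using exp_converges[of "exp (real m * u)"] by (intro sums_mult) (simp add: field_simps)
  show ?thesis unfolding S_bound_def sums_unique[OF sums]
    by (rule suminf_le[OF S_majorant_le[OF assms] summable_S_majorant[OF assms] sums_summable[OF sums]])
qed

lemma summable_norm_S_term: "Re z < 0 \<Longrightarrow> summable (\<lambda>n. norm (S_term m z n u))"
  by (rule summable_comparison_test'[of "\<lambda>n. Gamma (- Re z) / norm (Gamma (- z)) * S_majorant m (Re z) n u"])
     (use norm_S_term_le[of z m _ u] in \<open>auto intro!: summable_mult summable_S_majorant simp del: times_divide_eq_left\<close>)

lemma norm_S_hat_le:
  assumes "Re z < 0"
  shows "norm (S_hat m z (exp u)) \<le> Gamma (- Re z) / norm (Gamma (- z)) * S_bound m (Re z) u"
proof -
  have "norm (S_hat m z (exp u)) \<le> (\<Sum>n. norm (S_term m z n u))"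
    unfolding S_hat_exp by (rule summable_norm[OF summable_norm_S_term[OF assms]])
  also have "\<dots> \<le> (\<Sum>n. Gamma (- Re z) / norm (Gamma (- z)) * S_majorant m (Re z) n u)"
    by (intro suminf_le norm_S_term_le summable_norm_S_term summable_mult summable_S_majorant assms)
  also have "\<dots> = Gamma (- Re z) / norm (Gamma (- z)) * S_bound m (Re z) u"
    unfolding S_bound_def by (intro suminf_mult summable_S_majorant assms)
  finally show ?thesis .
qed

text \<open>
  Up to a power of \<open>x\<close>, the series is an everywhere convergent power series in \<open>x ^ m\<close>.
\<close>

lemma isCont_S_hat:
  assumes z: "Re z < 0"
  shows "isCont (\<lambda>u. S_hat m z (exp u)) u0"
proof -
  define c where "c n = 1 / (fact n * Gamma (of_nat (m * n) - z))" for n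
  have S_term_eq: "S_term m z n u = exp ((- z - 1) * of_real u) * (c n * of_real (exp (real m * u)) ^ n)" for n u
    by (simp add: S_term_def c_def exp_of_real[symmetric] exp_of_nat_mult[symmetric] exp_add[symmetric] algebra_simps)
  have c_summable: "summable (\<lambda>n. c n * y ^ n)" for y :: complex
  proof -
    let ?C = "Gamma (- Re z) / norm (Gamma (- z)) * exp (exp 1)"
    show ?thesis
    proof (rule summable_comparison_test')
      show "summable (\<lambda>n. ?C * (norm y ^ n / fact n))"
        using summable_exp[of "norm y"] by (intro summable_mult) (simp add: field_simps)
      show "norm (c n * y ^ n) \<le> ?C * (norm y ^ n / fact n)" for n
      proof -
        have "norm (c n) = norm (S_term m z n 0)" by (simp add: S_term_def c_def)
        also have "\<dots> \<le> Gamma (- Re z) / norm (Gamma (- z)) * S_majorant m (Re z) n 0" by (rule norm_S_term_le[OF z])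
        also have "\<dots> \<le> Gamma (- Re z) / norm (Gamma (- z)) * (exp (exp 1) * (1 / fact n))"
          using S_majorant_le[OF z, of m n 0] z by (intro mult_left_mono) (auto intro!: divide_nonneg_nonneg)
        finally have "norm (c n) * norm y ^ n \<le> Gamma (- Re z) / norm (Gamma (- z)) * (exp (exp 1) * (1 / fact n)) * norm y ^ n"
          by (intro mult_right_mono) auto
        then show ?thesis by (simp add: norm_mult norm_power)
      qed
    qed
  qed
  have "isCont (\<lambda>y. \<Sum>n. c n * y ^ n) (of_real (exp (real m * u0)))"
    by (rule isCont_powser_converges_everywhere[OF c_summable])
  then have "isCont (\<lambda>u. \<Sum>n. c n * of_real (exp (real m * u)) ^ n) u0"
    by (rule isCont_o2[rotated]) (intro continuous_intros)
  then have "isCont (\<lambda>u. exp ((- z - 1) * of_real u) * (\<Sum>n. c n * of_real (exp (real m * u)) ^ n)) u0"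
    by (intro continuous_intros)
  also have "(\<lambda>u. exp ((- z - 1) * of_real u) * (\<Sum>n. c n * of_real (exp (real m * u)) ^ n)) = (\<lambda>u. S_hat m z (exp u))"
    unfolding S_hat_exp S_term_eq fun_eq_iff by (intro allI suminf_mult[symmetric] c_summable)
  finally show ?thesis .
qed

lemma S_majorant_laplace:
  assumes \<gamma>: "\<gamma> < 0"
  shows "integrable lborel (\<lambda>u. exp (u - exp (u + q)) * S_majorant m \<gamma> n u)"
    and "(\<integral>u. exp (u - exp (u + q)) * S_majorant m \<gamma> n u \<partial>lborel) = exp (\<gamma> * q) * (exp (- (real m * q)) ^ n / fact n)"
proof -
  let ?a = "real (m * n) - \<gamma>"
  have a: "?a > 0" by (rule of_nat_minus_neg_pos[OF \<gamma>])
  have eq: "exp (u - exp (u + q)) * S_majorant m \<gamma> n u = 1 / (fact n * Gamma ?a) * exp (?a * u - exp (1 * u + q))" for u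
    by (simp add: S_majorant_def exp_add[symmetric] algebra_simps)
  note I = exp_log_integral_affine_real[OF a zero_less_one, of q]
  show "integrable lborel (\<lambda>u. exp (u - exp (u + q)) * S_majorant m \<gamma> n u)" unfolding eq using I(1) by simp
  have "(\<integral>u. exp (u - exp (u + q)) * S_majorant m \<gamma> n u \<partial>lborel) = 1 / (fact n * Gamma ?a) * (Gamma ?a * exp (- ?a * q))"
    unfolding eq integral_mult_right_zero using I(2) by simp
  also have "\<dots> = exp (- ?a * q) / fact n" using Gamma_real_pos[OF a] by simp
  also have "exp (- ?a * q) = exp (\<gamma> * q) * exp (- (real m * q)) ^ n"
    by (simp add: exp_of_nat_mult[symmetric] exp_add[symmetric] algebra_simps)
  finally show "(\<integral>u. exp (u - exp (u + q)) * S_majorant m \<gamma> n u \<partial>lborel) = exp (\<gamma> * q) * (exp (- (real m * q)) ^ n / fact n)"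
    by simp
qed

lemma S_term_laplace:
  assumes z: "Re z < 0"
  shows "integrable lborel (\<lambda>u. of_real (exp (u - exp (u + q))) * S_term m z n u)"
    and "(\<integral>u. of_real (exp (u - exp (u + q))) * S_term m z n u \<partial>lborel) = exp (z * of_real q) * (exp (- (of_nat m * of_real q)) ^ n / fact n)"
proof -
  let ?a = "of_nat (m * n) - z"
  have a: "Re ?a > 0" by (rule Re_of_nat_minus_neg_pos[OF z])
  have eq: "of_real (exp (u - exp (u + q))) * S_term m z n u = 1 / (fact n * Gamma ?a) * exp (?a * of_real u - of_real (exp (1 * u + q)))" for u
  proof -
    have "complex_of_real (exp (u - exp (u + q))) = exp (of_real u - of_real (exp (u + q)))"
      by (simp flip: exp_of_real)
    then show ?thesis by (simp add: S_term_def exp_add[symmetric] algebra_simps)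
  qed
  note I = exp_log_integral_affine[OF a zero_less_one, of q]
  show "integrable lborel (\<lambda>u. of_real (exp (u - exp (u + q))) * S_term m z n u)" unfolding eq using I(1) by simp
  have "(\<integral>u. of_real (exp (u - exp (u + q))) * S_term m z n u \<partial>lborel) = 1 / (fact n * Gamma ?a) * (Gamma ?a * exp (- ?a * of_real q))"
    unfolding eq integral_mult_right_zero using I(2) by simp
  also have "\<dots> = exp (- ?a * of_real q) / fact n" using Re_pos_not_nonpos_Int[OF a] by (simp add: Gamma_eq_zero_iff)
  also have "exp (- ?a * of_real q) = exp (z * of_real q) * exp (- (of_nat m * of_real q)) ^ n"
    by (simp add: exp_of_nat_mult[symmetric] exp_add[symmetric] algebra_simps)
  finally show "(\<integral>u. of_real (exp (u - exp (u + q))) * S_term m z n u \<partial>lborel) = exp (z * of_real q) * (exp (- (of_nat m * of_real q)) ^ n / fact n)"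
    by simp
qed

lemma integrable_S_bound_laplace:
  assumes \<gamma>: "\<gamma> < 0"
  shows "integrable lborel (\<lambda>u. exp (u - exp (u + q)) * S_bound m \<gamma> u)"
proof -
  have "integrable lborel (\<lambda>u. \<Sum>n. exp (u - exp (u + q)) * S_majorant m \<gamma> n u)"
  proof (rule integrable_suminf)
    show "AE u in lborel. summable (\<lambda>n. norm (exp (u - exp (u + q)) * S_majorant m \<gamma> n u))"
      using S_majorant_pos[OF \<gamma>] by (auto simp: abs_mult less_imp_le intro!: summable_mult summable_S_majorant \<gamma>)
    have "summable (\<lambda>n. exp (\<gamma> * q) * (exp (- (real m * q)) ^ n / fact n))"
      using summable_exp[of "exp (- (real m * q))"] by (intro summable_mult) (simp add: field_simps)
    then show "summable (\<lambda>n. \<integral>u. norm (exp (u - exp (u + q)) * S_majorant m \<gamma> n u) \<partial>lborel)"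
      using S_majorant_pos[OF \<gamma>] S_majorant_laplace(2)[OF \<gamma>] by (simp add: abs_mult less_imp_le)
  qed (rule S_majorant_laplace[OF \<gamma>])
  moreover have "(\<Sum>n. exp (u - exp (u + q)) * S_majorant m \<gamma> n u) = exp (u - exp (u + q)) * S_bound m \<gamma> u" for u
    unfolding S_bound_def by (intro suminf_mult summable_S_majorant \<gamma>)
  ultimately show ?thesis by simp
qed

text \<open>
  The gamma factors of the Laplace transforms of the powers cancel those of the series,
  leaving an exponential series in \<open>p powr (- m)\<close>, where \<open>p = exp q\<close>.
\<close>

lemma S_hat_laplace:
  assumes z: "Re z < 0"
  shows "(\<integral>u. of_real (exp (u - exp (u + q))) * S_hat m z (exp u) \<partial>lborel) = exp (z * of_real q) * of_real (exp (exp (- (real m * q))))"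
proof -
  let ?f = "\<lambda>n u. of_real (exp (u - exp (u + q))) * S_term m z n u"
  let ?C = "Gamma (- Re z) / norm (Gamma (- z))"
  have norm_f: "norm (?f n u) \<le> ?C * (exp (u - exp (u + q)) * S_majorant m (Re z) n u)" for n u
    using mult_left_mono[OF norm_S_term_le[OF z, of m n u], of "exp (u - exp (u + q))"] by (simp add: norm_mult mult_ac)
  have "(\<lambda>n. \<integral>u. ?f n u \<partial>lborel) sums (\<integral>u. (\<Sum>n. ?f n u) \<partial>lborel)"
  proof (rule sums_integral)
    show "AE u in lborel. summable (\<lambda>n. norm (?f n u))"
      using summable_norm_S_term[OF z] by (auto simp: norm_mult intro!: summable_mult)
    have "summable (\<lambda>n. ?C * (exp (Re z * q) * (exp (- (real m * q)) ^ n / fact n)))"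
      using summable_exp[of "exp (- (real m * q))"] by (intro summable_mult) (simp add: field_simps)
    moreover have "norm (\<integral>u. norm (?f n u) \<partial>lborel) \<le> ?C * (exp (Re z * q) * (exp (- (real m * q)) ^ n / fact n))" for n
    proof -
      have "(\<integral>u. norm (?f n u) \<partial>lborel) \<le> (\<integral>u. ?C * (exp (u - exp (u + q)) * S_majorant m (Re z) n u) \<partial>lborel)"
        using norm_f by (intro integral_mono integrable_norm S_term_laplace z integrable_mult_right S_majorant_laplace) auto
      then show ?thesis unfolding integral_mult_right_zero S_majorant_laplace(2)[OF z] by simp
    qed
    ultimately show "summable (\<lambda>n. \<integral>u. norm (?f n u) \<partial>lborel)" by (rule summable_comparison_test')
  qed (rule S_term_laplace[OF z])
  then have 1: "(\<lambda>n. exp (z * of_real q) * (exp (- (of_nat m * of_real q)) ^ n / fact n)) sums (\<integral>u. (\<Sum>n. ?f n u) \<partial>lborel)"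
    unfolding S_term_laplace(2)[OF z] .
  have 2: "(\<lambda>n. exp (z * of_real q) * (exp (- (of_nat m * of_real q)) ^ n / fact n)) sums (exp (z * of_real q) * exp (exp (- (of_nat m * of_real q))))"
    using exp_converges[of "exp (- (of_nat m * complex_of_real q))"] by (intro sums_mult) (simp add: scaleR_conv_of_real field_simps)
  have "(\<Sum>n. ?f n u) = of_real (exp (u - exp (u + q))) * S_hat m z (exp u)" for u
    unfolding S_hat_exp using summable_norm_cancel[OF summable_norm_S_term[OF z]] by (rule suminf_mult)
  moreover have "exp (exp (- (of_nat m * of_real q))) = complex_of_real (exp (exp (- (real m * q))))"
    by (simp flip: exp_of_real)
  ultimately show ?thesis using sums_unique2[OF 1 2] by simp
qed

section \<open>Uniqueness of the Laplace transform\<close>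

text \<open>
  The weight \<open>exp (u - exp (u + q))\<close> is \<open>exp (- p x) dx\<close> for \<open>x = exp u\<close> and \<open>p = exp q\<close>. The
  Laplace transform vanishes for \<open>p > 0\<close>, hence by analytic continuation also on the line
  \<open>Re p = 1\<close>, where it is the Fourier transform of \<open>exp (- x)\<close> times the function; Fourier
  inversion concludes.
\<close>

lemma laplace_unique:
  fixes h :: "real \<Rightarrow> complex"
  assumes h_meas [measurable]: "h \<in> borel_measurable borel"
    and int: "\<And>q. integrable lborel (\<lambda>u. of_real (exp (u - exp (u + q))) * h u)"
    and zero: "\<And>q. (\<integral>u. of_real (exp (u - exp (u + q))) * h u \<partial>lborel) = 0"
    and cont: "isCont h u0"
  shows "h u0 = 0"
proof -
  define \<Psi> where "\<Psi> w = (\<integral>u. exp (of_real u - w * of_real (exp u)) * h u \<partial>lborel)" for w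
  \<comment> \<open>The half-plane \<open>Re w > 1 / 2\<close> contains the line \<open>Re w = 1\<close>, and the integrand is dominated
    there by the one at \<open>w = 1 / 2\<close>, that is, \<open>q = ln (1 / 2)\<close>.\<close>
  define H where "H = {w. Re w > 1 / 2}"
  have "open H" unfolding H_def by (rule open_halfspace_Re_gt)
  have "convex H" unfolding H_def by (rule convex_halfspace_Re_gt)
  have half: "exp (ln (1 / 2) :: real) = 1 / 2" by simp
  have "\<Psi> holomorphic_on H"
    unfolding \<Psi>_def[abs_def]
  proof (rule holomorphic_on_parametric_integral[OF \<open>open H\<close>])
    show "integrable lborel (\<lambda>u. norm (of_real (exp (u - exp (u + ln (1/2)))) * h u))" by (intro integrable_norm int)
    show "norm (exp (of_real u - w * of_real (exp u)) * h u) \<le> norm (of_real (exp (u - exp (u + ln (1/2)))) * h u)" if "w \<in> H" for u w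
      using that unfolding exp_add half by (auto simp: H_def norm_mult intro!: mult_right_mono)
  qed (auto intro!: holomorphic_intros)
  then have \<Psi>_zero: "\<Psi> w = 0" if "w \<in> H" for w
  proof (rule analytic_continuation[OF _ \<open>open H\<close> convex_connected[OF \<open>convex H\<close>]])
    let ?U = "of_real ` {1/2<..} :: complex set"
    show "?U \<subseteq> H" by (auto simp: H_def)
    show "1 \<in> H" by (simp add: H_def)
    show "1 islimpt ?U"
    proof -
      have "(\<lambda>n. 1 + 1 / of_nat (Suc n) :: complex) \<longlonglongrightarrow> 1" 
        using tendsto_add[OF tendsto_const LIMSEQ_Suc[OF lim_1_over_n], of "1::complex"] by simp
      moreover have "1 + 1 / of_nat (Suc n) \<in> ?U - {1}" for n
      proof -
        have "1 + 1 / of_nat (Suc n) = complex_of_real (1 + 1 / real (Suc n))" by simp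
        moreover have "1 + 1 / real (Suc n) \<in> {1/2<..}" by (simp add: field_simps)
        ultimately have "1 + 1 / of_nat (Suc n) \<in> ?U" by blast
        then show ?thesis by (simp add: of_nat_neq_0 del: of_nat_Suc)
      qed
      ultimately show ?thesis unfolding islimpt_sequential by (intro exI[of _ "\<lambda>n. 1 + 1 / of_nat (Suc n)"]) auto
    qed
    show "\<Psi> w = 0" if w: "w \<in> ?U" for w
    proof -
      obtain p where p: "w = of_real p" "p > 1 / 2" using w by auto
      have "exp (of_real u - w * of_real (exp u)) = complex_of_real (exp (u - exp (u + ln p)))" for u
      proof -
        have "exp (u + ln p) = p * exp u" using p by (simp add: exp_add)
        then show ?thesis unfolding p(1) by (simp flip: exp_of_real)
      qed
      then show ?thesis unfolding \<Psi>_def using zero by simp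
    qed
    show "w \<in> H" by fact
  qed
  \<comment> \<open>Back to the coordinate \<open>x = exp u\<close>, in which \<open>\<Psi> (1 - \<i> t)\<close> is a Fourier transform.\<close>
  define h1 where "h1 x = indicator {0<..} x *\<^sub>R (exp (- complex_of_real x) * h (ln x))" for x :: real
  have h1_meas [measurable]: "h1 \<in> borel_measurable borel" unfolding h1_def[abs_def] by measurable
  have zero_hat: "set_integrable lebesgue {0<..} (\<lambda>x. iexp (t * x) * (exp (- complex_of_real x) * h (ln x))) \<and>
     (LINT x:{0<..}|lebesgue. iexp (t * x) * (exp (- complex_of_real x) * h (ln x))) = 0" for t
  proof -
    let ?g = "\<lambda>x. iexp (t * x) * (exp (- complex_of_real x) * h (ln x))"
    have g: "exp u *\<^sub>R ?g (exp u) = exp (of_real u - (1 - \<i> * of_real t) * of_real (exp u)) * h u" for u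
    proof -
      have "exp (of_real u - (1 - \<i> * of_real t) * of_real (exp u)) = of_real (exp u) * (iexp (t * exp u) * exp (- complex_of_real (exp u)))"
        by (simp add: exp_of_real[symmetric] exp_add[symmetric] algebra_simps)
      then show ?thesis by (simp add: scaleR_conv_of_real)
    qed
    have "integrable lborel (\<lambda>u. exp u *\<^sub>R ?g (exp u))" unfolding g
    proof (rule Bochner_Integration.integrable_bound[OF int[of 0]])
      show "AE u in lborel. norm (exp (of_real u - (1 - \<i> * of_real t) * of_real (exp u)) * h u) \<le> norm (of_real (exp (u - exp (u + 0))) * h u)"
        by (auto simp: norm_mult)
    qed measurable
    note I = integrable_lborel_imp_lebesgue[OF this]
    have "(\<integral>u. exp u *\<^sub>R ?g (exp u) \<partial>lborel) = \<Psi> (1 - \<i> * of_real t)" unfolding g \<Psi>_def ..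
    also have "\<dots> = 0" by (rule \<Psi>_zero) (simp add: H_def)
    finally show ?thesis
      using I set_integrable_exp_substitution[of ?g] set_integral_exp_substitution[of ?g] by simp
  qed
  have "integrable lebesgue h1"
    using zero_hat[of 0] by (simp add: set_integrable_def h1_def[abs_def])
  then have h1_int: "integrable lborel h1" by (rule integrable_lebesgue_imp_lborel[OF h1_meas])
  have hat: "(\<integral>x. iexp (t * x) * h1 x \<partial>lborel) = 0" for t
  proof -
    have "(\<integral>x. iexp (t * x) * h1 x \<partial>lborel) = (\<integral>x. iexp (t * x) * h1 x \<partial>lebesgue)"
      by (rule integral_completion[symmetric]) simp
    also have "\<dots> = (LINT x:{0<..}|lebesgue. iexp (t * x) * (exp (- complex_of_real x) * h (ln x)))"
      unfolding set_lebesgue_integral_def h1_def by (intro Bochner_Integration.integral_cong) auto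
    finally show ?thesis using zero_hat by simp
  qed
  have "isCont h1 (exp u0)"
  proof -
    have "eventually (\<lambda>x. x \<in> {0<..}) (nhds (exp u0))" by (intro eventually_nhds_in_open) auto
    then have "eventually (\<lambda>x. h1 x = exp (- complex_of_real x) * h (ln x)) (nhds (exp u0))"
      by eventually_elim (simp add: h1_def)
    moreover have "isCont (\<lambda>x. exp (- complex_of_real x) * h (ln x)) (exp u0)"
      using cont by (intro continuous_intros isCont_o2[of "exp u0" ln h]) auto
    ultimately show ?thesis by (rule isCont_cong[THEN iffD2])
  qed
  from fourier_inversion[OF h1_int this] have "2 * pi * h1 (exp u0) = 0" unfolding hat by simp
  then show ?thesis by (simp add: h1_def)
qed

section \<open>The inversion formula\<close>

lemma isCont_log_mellin:
  assumes \<phi>: "integrable lborel \<phi>"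
  shows "isCont (log_mellin c0 \<phi>) u0"
proof -
  have [measurable]: "\<phi> \<in> borel_measurable borel" using \<phi> by (simp add: borel_measurable_integrable)
  have "isCont (\<lambda>u. \<integral>t. \<phi> t * exp (- (Complex c0 t * of_real u)) \<partial>lborel) u0"
    by (rule isCont_parametric_integral[where w=\<phi> and g="\<lambda>u. exp (- (c0 * u))"])
       (use \<phi> in \<open>auto simp: norm_mult intro!: continuous_intros\<close>)
  then show ?thesis unfolding log_mellin_def[abs_def] by (intro continuous_intros)
qed

lemma log_mellin_laplace:
  assumes c0: "c0 < 1" and \<phi>: "integrable lborel \<phi>"
  shows "integrable lborel (\<lambda>u. of_real (exp (u - exp (u + q))) * log_mellin c0 \<phi> u)"
    and "(\<integral>u. of_real (exp (u - exp (u + q))) * log_mellin c0 \<phi> u \<partial>lborel)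
       = 1 / (2 * of_real pi) * (\<integral>t. \<phi> t * (Gamma (1 - Complex c0 t) * exp (- (1 - Complex c0 t) * of_real q)) \<partial>lborel)"
proof -
  have [measurable]: "\<phi> \<in> borel_measurable borel" using \<phi> by (simp add: borel_measurable_integrable)
  have a: "Re (1 - Complex c0 t) > 0" for t using c0 by simp
  define F where "F = (\<lambda>t u. \<phi> t * exp ((1 - Complex c0 t) * of_real u - of_real (exp (1 * u + q))))"
  have F_int: "integrable (lborel \<Otimes>\<^sub>M lborel) (case_prod F)"
  proof (rule integrable_pair_sheared_product[where \<kappa> = 0 and a="\<lambda>t. norm (\<phi> t)" and
        b="\<lambda>u. exp ((1 - c0) * u - exp (1 * u + q))"])
    show "case_prod F \<in> borel_measurable (lborel \<Otimes>\<^sub>M lborel)" unfolding F_def by measurable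
    show "integrable lborel (\<lambda>u. exp ((1 - c0) * u - exp (1 * u + q)))"
      using c0 by (intro exp_log_integral_affine_real) auto
  qed (use \<phi> in \<open>auto simp: F_def norm_mult\<close>)
  have inner_u: "(\<integral>u. F t u \<partial>lborel) = \<phi> t * (Gamma (1 - Complex c0 t) * exp (- (1 - Complex c0 t) * of_real q))" for t
    unfolding F_def using exp_log_integral_affine(2)[OF a zero_less_one, of t q] by simp
  have inner_t: "(\<integral>t. F t u \<partial>lborel) = 2 * of_real pi * (of_real (exp (u - exp (u + q))) * log_mellin c0 \<phi> u)" for u
  proof -
    have "F t u = of_real (exp (u - exp (u + q))) * (\<phi> t * exp (- (Complex c0 t * of_real u)))" for t
    proof -
      have "exp ((1 - Complex c0 t) * of_real u - of_real (exp (1 * u + q))) = exp (of_real (u - exp (u + q))) * exp (- (Complex c0 t * of_real u))"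
        by (simp add: exp_add[symmetric] algebra_simps)
      then show ?thesis unfolding F_def exp_of_real by (simp only: mult_ac)
    qed
    then have "(\<integral>t. F t u \<partial>lborel) = of_real (exp (u - exp (u + q))) * (\<integral>t. \<phi> t * exp (- (Complex c0 t * of_real u)) \<partial>lborel)"
      by (simp only: integral_mult_right_zero)
    then show ?thesis by (simp add: log_mellin_def)
  qed
  have "integrable lborel (\<lambda>u. 1 / (2 * of_real pi) * (2 * of_real pi * (of_real (exp (u - exp (u + q))) * log_mellin c0 \<phi> u)))"
    using lborel_pair.integrable_snd[OF F_int] unfolding inner_t by (rule integrable_mult_right)
  then show "integrable lborel (\<lambda>u. of_real (exp (u - exp (u + q))) * log_mellin c0 \<phi> u)" by simp
  have "2 * of_real pi * (\<integral>u. of_real (exp (u - exp (u + q))) * log_mellin c0 \<phi> u \<partial>lborel)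
      = (\<integral>t. \<phi> t * (Gamma (1 - Complex c0 t) * exp (- (1 - Complex c0 t) * of_real q)) \<partial>lborel)"
    using lborel_pair.Fubini_integral[OF F_int] unfolding inner_t inner_u integral_mult_right_zero .
  then show "(\<integral>u. of_real (exp (u - exp (u + q))) * log_mellin c0 \<phi> u \<partial>lborel)
       = 1 / (2 * of_real pi) * (\<integral>t. \<phi> t * (Gamma (1 - Complex c0 t) * exp (- (1 - Complex c0 t) * of_real q)) \<partial>lborel)"
    by (simp add: field_simps)
qed

text \<open>
  Apart from the factor \<open>exp (- p powr (- m))\<close> with \<open>p = exp q\<close>, the right-hand side is \<open>2 \<pi>\<close>
  times the Laplace transform of \<open>log_mellin c0 \<phi>\<close> at \<open>p\<close>. After interchanging the integrals,
  the inner one is the Cahen-Mellin integral.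
\<close>

lemma gamma_transform_mellin_inversion:
  assumes m: "m \<ge> 1" and c0: "c0 < 1" and \<gamma>: "\<gamma> > c0 - 1" and \<phi>: "integrable lborel \<phi>"
  shows "(\<integral>\<tau>. gamma_transform c0 m \<phi> (Complex \<gamma> \<tau>) * exp (Complex \<gamma> \<tau> * of_real q) \<partial>lborel)
    = of_real (exp (- exp (- (real m * q)))) * (\<integral>t. \<phi> t * (Gamma (1 - Complex c0 t) * exp (- (1 - Complex c0 t) * of_real q)) \<partial>lborel)"
proof -
  have [measurable]: "\<phi> \<in> borel_measurable borel" using \<phi> by (simp add: borel_measurable_integrable)
  note bounds = gamma_integrand_bounds[OF m c0 \<gamma> \<phi>]
  define F where "F = (\<lambda>t \<tau>. gamma_integrand c0 m \<phi> \<gamma> t \<tau> * exp (Complex \<gamma> \<tau> * of_real q))"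
  have F_int: "integrable (lborel \<Otimes>\<^sub>M lborel) (case_prod F)"
  proof (rule integrable_pair_sheared_product[where \<kappa> = 1 and a="\<lambda>t. Gamma (1 - c0) * norm (\<phi> t)" and
        b="\<lambda>\<tau>. norm (Gamma (Complex (1 - c0 + \<gamma>) \<tau> / of_nat m)) * exp (\<gamma> * q)"])
    show "case_prod F \<in> borel_measurable (lborel \<Otimes>\<^sub>M lborel)" unfolding F_def gamma_integrand_def by measurable
    show "integrable lborel (\<lambda>\<tau>. norm (Gamma (Complex (1 - c0 + \<gamma>) \<tau> / of_nat m)) * exp (\<gamma> * q))"
      using bounds(3) by (rule integrable_mult_left)
    show "norm (F t \<tau>) \<le> Gamma (1 - c0) * norm (\<phi> t) * (norm (Gamma (Complex (1 - c0 + \<gamma>) (\<tau> - 1 * t) / of_nat m)) * exp (\<gamma> * q))" for t \<tau>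
      using mult_right_mono[OF bounds(4)[of t \<tau>], of "exp (\<gamma> * q)"] by (simp add: F_def norm_mult)
  qed (rule bounds(2))
  \<comment> \<open>The abscissa of the argument \<open>(1 - s + z) / m\<close>, which describes a vertical line as \<open>z\<close> does.\<close>
  define \<sigma> where "\<sigma> = (1 - c0 + \<gamma>) / real m"
  have \<sigma>: "\<sigma> > 0" using m \<gamma> by (simp add: \<sigma>_def)
  have inner_\<tau>: "(\<integral>\<tau>. F t \<tau> \<partial>lborel) = 2 * of_real pi * of_nat m * (of_real (exp (- exp (- (real m * q))))
      * (\<phi> t * (Gamma (1 - Complex c0 t) * exp (- (1 - Complex c0 t) * of_real q))))" for t
  proof -
    let ?P = "\<phi> t * (Gamma (1 - Complex c0 t) * exp (- (1 - Complex c0 t) * of_real q))"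
    let ?E = "\<lambda>\<tau>. Gamma (Complex \<sigma> \<tau>) * exp (- (Complex \<sigma> \<tau> * of_real (- (real m * q))))"
    have arg: "(1 - Complex c0 t + Complex \<gamma> (t + real m * \<tau>)) / of_nat m = Complex \<sigma> \<tau>" for \<tau>
      using m by (simp add: \<sigma>_def complex_eq_iff field_simps)
    have expo: "exp (Complex \<gamma> (t + real m * \<tau>) * of_real q)
        = exp (- (1 - Complex c0 t) * of_real q) * exp (- (Complex \<sigma> \<tau> * of_real (- (real m * q))))" for \<tau>
    proof -
      have "Complex \<gamma> (t + real m * \<tau>) = - (1 - Complex c0 t) + Complex \<sigma> \<tau> * of_nat m"
        using m by (simp add: \<sigma>_def complex_eq_iff)
      then show ?thesis by (simp only:) (simp add: exp_add[symmetric] algebra_simps)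
    qed
    \<comment> \<open>With \<open>\<tau>\<close> replaced by \<open>t + m \<tau>\<close> the gamma factor is taken at \<open>Complex \<sigma> \<tau>\<close>.\<close>
    have "F t (t + real m * \<tau>) = ?P * ?E \<tau>" for \<tau>
      unfolding F_def gamma_integrand_def arg expo by (simp only: mult_ac)
    then have "(\<integral>\<tau>. F t \<tau> \<partial>lborel) = real m *\<^sub>R (\<integral>\<tau>. ?P * ?E \<tau> \<partial>lborel)"
      using m by (subst lborel_integral_real_affine[of "real m" _ t]) simp_all
    also have "(\<integral>\<tau>. ?P * ?E \<tau> \<partial>lborel) = ?P * of_real (2 * pi * exp (- exp (- (real m * q))))"
      unfolding integral_mult_right_zero cahen_mellin[OF \<sigma>] ..
    finally show ?thesis by (simp add: scaleR_conv_of_real)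
  qed
  have inner_t: "(\<integral>t. F t \<tau> \<partial>lborel) = 2 * of_real pi * of_nat m * (gamma_transform c0 m \<phi> (Complex \<gamma> \<tau>) * exp (Complex \<gamma> \<tau> * of_real q))" for \<tau>
    unfolding F_def gamma_transform_line using m by simp
  show ?thesis
    using lborel_pair.Fubini_integral[OF F_int] m unfolding inner_t inner_\<tau> integral_mult_right_zero by simp
qed

lemma borel_measurable_S_hat [measurable]:
  "(\<lambda>(\<tau>, u). S_hat m (Complex \<gamma> \<tau>) (exp u)) \<in> borel_measurable (lborel \<Otimes>\<^sub>M lborel)"
  unfolding S_hat_exp S_term_def by measurable

text \<open>
  Both sides are continuous and have the same Laplace transform: on the right, the factor
  \<open>exp (p powr (- m))\<close> from the transform of \<open>S_hat\<close> cancels the factor \<open>exp (- p powr (- m))\<close>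
  from the contour integral of \<open>F f\<close>.
\<close>

lemma log_mellin_inversion:
  assumes m: "m \<ge> 1" and c0: "c0 < 1" and \<gamma>: "\<gamma> > c0 - 1" "\<gamma> < 0" and \<phi>: "integrable lborel \<phi>"
    and quot: "integrable lborel (\<lambda>\<tau>. gamma_transform c0 m \<phi> (Complex \<gamma> \<tau>) / Gamma (- Complex \<gamma> \<tau>))"
  shows "integrable lborel (\<lambda>\<tau>. S_hat m (Complex \<gamma> \<tau>) (exp u) * gamma_transform c0 m \<phi> (Complex \<gamma> \<tau>))"
    and "log_mellin c0 \<phi> u = 1 / (2 * of_real pi) * (\<integral>\<tau>. S_hat m (Complex \<gamma> \<tau>) (exp u) * gamma_transform c0 m \<phi> (Complex \<gamma> \<tau>) \<partial>lborel)"
proof -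
  let ?T = "\<lambda>\<tau>. gamma_transform c0 m \<phi> (Complex \<gamma> \<tau>)"
  \<comment> \<open>For fixed \<open>u\<close> the integrand is bounded by a multiple of \<open>norm (?Q \<tau>)\<close>; the factor \<open>\<Gamma>(- \<gamma>)\<close>
    comes from \<open>norm_S_hat_le\<close>.\<close>
  let ?Q = "\<lambda>\<tau>. Gamma (- \<gamma>) * (?T \<tau> / Gamma (- Complex \<gamma> \<tau>))"
  have T_int: "integrable lborel ?T" by (rule gamma_transform_vertical_L1[OF m c0 \<gamma>(1) \<phi>])
  then have [measurable]: "?T \<in> borel_measurable borel" by (simp add: borel_measurable_integrable)
  have [measurable]: "(\<lambda>\<tau>. S_hat m (Complex \<gamma> \<tau>) (exp u)) \<in> borel_measurable borel" for u
    unfolding S_hat_exp S_term_def by measurable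
  have Q_int: "integrable lborel ?Q" using quot by (rule integrable_mult_right)
  have bound: "norm (S_hat m (Complex \<gamma> \<tau>) (exp u) * ?T \<tau>) \<le> norm (?Q \<tau>) * S_bound m \<gamma> u" for \<tau> u
  proof -
    have "norm (S_hat m (Complex \<gamma> \<tau>) (exp u)) \<le> Gamma (- \<gamma>) / norm (Gamma (- Complex \<gamma> \<tau>)) * S_bound m \<gamma> u"
      using norm_S_hat_le[of "Complex \<gamma> \<tau>" m u] \<gamma> by simp
    from mult_right_mono[OF this norm_ge_zero[of "?T \<tau>"]] show ?thesis
      using \<gamma> by (simp add: norm_mult norm_divide mult_ac)
  qed
  show int: "integrable lborel (\<lambda>\<tau>. S_hat m (Complex \<gamma> \<tau>) (exp u) * ?T \<tau>)" for u
  proof (rule Bochner_Integration.integrable_bound)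
    show "integrable lborel (\<lambda>\<tau>. norm (?Q \<tau>) * S_bound m \<gamma> u)"
      by (intro integrable_mult_left integrable_norm Q_int)
    show "AE \<tau> in lborel. norm (S_hat m (Complex \<gamma> \<tau>) (exp u) * ?T \<tau>) \<le> norm (norm (?Q \<tau>) * S_bound m \<gamma> u)"
      using bound by (intro AE_I2) (simp only: real_norm_def, rule order.trans[OF _ abs_ge_self])
  qed measurable
  define R where "R u = 1 / (2 * of_real pi) * (\<integral>\<tau>. S_hat m (Complex \<gamma> \<tau>) (exp u) * ?T \<tau> \<partial>lborel)" for u
  have R_cont: "isCont R u0" for u0
  proof -
    have "isCont (\<lambda>u. \<integral>\<tau>. S_hat m (Complex \<gamma> \<tau>) (exp u) * ?T \<tau> \<partial>lborel) u0"
    proof (rule isCont_parametric_integral[where w="?Q" and g="\<lambda>u. exp ((- \<gamma> - 1) * u) * exp (exp 1) * exp (exp (real m * u))"])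
      show "isCont (\<lambda>u. S_hat m (Complex \<gamma> \<tau>) (exp u) * ?T \<tau>) u0" for \<tau>
        using \<gamma> by (intro continuous_intros isCont_S_hat) simp
      show "norm (S_hat m (Complex \<gamma> \<tau>) (exp u) * ?T \<tau>) \<le> norm (?Q \<tau>) * (exp ((- \<gamma> - 1) * u) * exp (exp 1) * exp (exp (real m * u)))" for \<tau> u
        by (rule order.trans[OF bound]) (intro mult_left_mono S_bound_le \<gamma> norm_ge_zero)
      show "isCont (\<lambda>u. exp ((- \<gamma> - 1) * u) * exp (exp 1) * exp (exp (real m * u))) u0"
        by (intro continuous_intros)
      show "(\<lambda>\<tau>. S_hat m (Complex \<gamma> \<tau>) (exp u) * ?T \<tau>) \<in> borel_measurable lborel" for u by measurable
    qed (rule Q_int)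
    then show ?thesis unfolding R_def[abs_def] by (intro continuous_intros)
  qed
  have R_laplace: "integrable lborel (\<lambda>u. of_real (exp (u - exp (u + q))) * R u)"
      "(\<integral>u. of_real (exp (u - exp (u + q))) * R u \<partial>lborel) = (\<integral>u. of_real (exp (u - exp (u + q))) * log_mellin c0 \<phi> u \<partial>lborel)" for q
  proof -
    define F where "F = (\<lambda>\<tau> u. of_real (exp (u - exp (u + q))) * (S_hat m (Complex \<gamma> \<tau>) (exp u) * ?T \<tau>))"
    have F_int: "integrable (lborel \<Otimes>\<^sub>M lborel) (case_prod F)"
    proof (rule integrable_pair_sheared_product[where \<kappa> = 0 and a="\<lambda>\<tau>. norm (?Q \<tau>)" and
          b="\<lambda>u. exp (u - exp (u + q)) * S_bound m \<gamma> u"])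
      show "case_prod F \<in> borel_measurable (lborel \<Otimes>\<^sub>M lborel)" unfolding F_def by measurable
      show "integrable lborel (\<lambda>\<tau>. norm (?Q \<tau>))" using Q_int by (rule integrable_norm)
      show "integrable lborel (\<lambda>u. exp (u - exp (u + q)) * S_bound m \<gamma> u)" by (rule integrable_S_bound_laplace[OF \<gamma>(2)])
      show "norm (F \<tau> u) \<le> norm (?Q \<tau>) * (exp (u - 0 * \<tau> - exp (u - 0 * \<tau> + q)) * S_bound m \<gamma> (u - 0 * \<tau>))" for \<tau> u
        using mult_left_mono[OF bound[of \<tau> u], of "exp (u - exp (u + q))"] by (simp add: F_def norm_mult mult_ac)
    qed
    have inner_\<tau>: "(\<integral>\<tau>. F \<tau> u \<partial>lborel) = 2 * of_real pi * (of_real (exp (u - exp (u + q))) * R u)" for u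
      unfolding F_def R_def by simp
    have inner_u: "(\<integral>u. F \<tau> u \<partial>lborel) = of_real (exp (exp (- (real m * q)))) * (?T \<tau> * exp (Complex \<gamma> \<tau> * of_real q))" for \<tau>
    proof -
      have "(\<integral>u. F \<tau> u \<partial>lborel) = (\<integral>u. ?T \<tau> * (of_real (exp (u - exp (u + q))) * S_hat m (Complex \<gamma> \<tau>) (exp u)) \<partial>lborel)"
        unfolding F_def by (simp only: mult_ac)
      then show ?thesis
        unfolding integral_mult_right_zero using S_hat_laplace[of "Complex \<gamma> \<tau>" q m] \<gamma> by (simp add: mult_ac)
    qed
    have "integrable lborel (\<lambda>u. 1 / (2 * of_real pi) * (2 * of_real pi * (of_real (exp (u - exp (u + q))) * R u)))"
      using lborel_pair.integrable_snd[OF F_int] unfolding inner_\<tau> by (rule integrable_mult_right)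
    then show "integrable lborel (\<lambda>u. of_real (exp (u - exp (u + q))) * R u)" by simp
    have "2 * of_real pi * (\<integral>u. of_real (exp (u - exp (u + q))) * R u \<partial>lborel)
        = of_real (exp (exp (- (real m * q)))) * (\<integral>\<tau>. ?T \<tau> * exp (Complex \<gamma> \<tau> * of_real q) \<partial>lborel)"
      using lborel_pair.Fubini_integral[OF F_int] unfolding inner_\<tau> inner_u integral_mult_right_zero .
    also have "\<dots> = of_real (exp (exp (- (real m * q))) * exp (- exp (- (real m * q)))) * (\<integral>t. \<phi> t * (Gamma (1 - Complex c0 t) * exp (- (1 - Complex c0 t) * of_real q)) \<partial>lborel)"
      unfolding gamma_transform_mellin_inversion[OF m c0 \<gamma>(1) \<phi>] of_real_mult by (simp only: mult.assoc)
    also have "exp (exp (- (real m * q))) * exp (- exp (- (real m * q))) = 1" by (simp add: exp_add[symmetric])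
    also have "of_real 1 * (\<integral>t. \<phi> t * (Gamma (1 - Complex c0 t) * exp (- (1 - Complex c0 t) * of_real q)) \<partial>lborel)
        = 2 * of_real pi * (\<integral>u. of_real (exp (u - exp (u + q))) * log_mellin c0 \<phi> u \<partial>lborel)"
      unfolding log_mellin_laplace(2)[OF c0 \<phi>] by simp
    finally show "(\<integral>u. of_real (exp (u - exp (u + q))) * R u \<partial>lborel) = (\<integral>u. of_real (exp (u - exp (u + q))) * log_mellin c0 \<phi> u \<partial>lborel)"
      by simp
  qed
  have "log_mellin c0 \<phi> u - R u = 0"
  proof (rule laplace_unique[where h="\<lambda>u. log_mellin c0 \<phi> u - R u"])
    have cont: "isCont (\<lambda>u. log_mellin c0 \<phi> u - R u) u0" for u0
      by (intro continuous_intros isCont_log_mellin \<phi> R_cont)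
    then show "isCont (\<lambda>u. log_mellin c0 \<phi> u - R u) u" .
    show "(\<lambda>u. log_mellin c0 \<phi> u - R u) \<in> borel_measurable borel"
      using cont by (intro borel_measurable_continuous_onI continuous_at_imp_continuous_on) auto
    show "integrable lborel (\<lambda>u. of_real (exp (u - exp (u + q))) * (log_mellin c0 \<phi> u - R u))" for q
      unfolding right_diff_distrib by (intro Bochner_Integration.integrable_diff log_mellin_laplace c0 \<phi> R_laplace)
    show "(\<integral>u. of_real (exp (u - exp (u + q))) * (log_mellin c0 \<phi> u - R u) \<partial>lborel) = 0" for q
      unfolding right_diff_distrib
      by (subst Bochner_Integration.integral_diff[OF log_mellin_laplace(1)[OF c0 \<phi>] R_laplace(1)]) (simp add: R_laplace(2))
  qed
  then show "log_mellin c0 \<phi> u = 1 / (2 * of_real pi) * (\<integral>\<tau>. S_hat m (Complex \<gamma> \<tau>) (exp u) * ?T \<tau> \<partial>lborel)"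
    by (simp add: R_def)
qed

lemma prod_Gamma_quotient:
  assumes m: "m \<ge> 1" and z: "Re z < 0"
  shows "(\<Prod>k<m. Gamma ((of_nat k - z) / of_nat m))
       = of_real ((2 * pi) powr ((real m - 1) / 2) * sqrt (real m)) * exp (z * of_real (ln (real m))) * Gamma (- z)"
proof -
  have "of_nat m * (- z / of_nat m) = - z" using m by simp
  moreover have "- z \<notin> \<int>\<^sub>\<le>\<^sub>0" using z by (intro Re_pos_not_nonpos_Int) simp
  ultimately show ?thesis
    using Gamma_multiplication[OF m, of "- z / of_nat m"] by (simp add: diff_divide_distrib)
qed

theorem theorem5:
  fixes m :: nat and c0 :: real and \<mu> :: "complex \<Rightarrow> real"
    and f :: "real \<Rightarrow> complex" and fs :: "complex \<Rightarrow> complex"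
  assumes m: "m \<ge> 1"
    and c0: "c0 < 1"
    and \<mu>: "\<And>z. \<mu> z > max 0 (- Re z / real m)"
    and f: "mellin_rep c0 f fs"
  shows "(\<forall>z. Re z > c0 - 1 \<longrightarrow>
            (\<forall>w>0. meijer_integrand m z w \<in> line_L1 (\<mu> z)) \<and>
            set_integrable lebesgue {0<..} (\<lambda>x. meijer_G (\<mu> z) m z ((x / real m) ^ m) * f x))
       \<and> index_transform \<mu> m f analytic_on {z. Re z > c0 - 1}
       \<and> (\<forall>z. Re z > c0 - 1 \<longrightarrow>
            (\<lambda>s. Gamma ((1 - s + z) / of_nat m) * Gamma (1 - s) * fs s) \<in> line_L1 c0 \<and>
            index_transform \<mu> m f z = 1 / (2 * of_real pi * \<i> * of_nat m) *
              line_integral c0 (\<lambda>s. Gamma ((1 - s + z) / of_nat m) * Gamma (1 - s) * fs s))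
       \<and> (\<forall>\<gamma>>c0 - 1.
            bounded_operator c0 \<gamma> (index_transform \<mu> m) \<and>
            operator_norm c0 \<gamma> (index_transform \<mu> m) \<le>
              Gamma (1 - c0) *
              (LINT \<tau>|lebesgue. norm (Gamma (1 / of_nat m * Complex (1 - c0 + \<gamma>) \<tau>))))
       \<and> (\<forall>\<gamma>. c0 - 1 < \<gamma> \<and> \<gamma> < 0 \<and>
            (\<lambda>z. index_transform \<mu> m f z / (\<Prod>k<m. Gamma ((of_nat k - z) / of_nat m)))
              \<in> line_L1 \<gamma> \<longrightarrow>
            (\<forall>x>0. (\<lambda>z. S_hat m z x * index_transform \<mu> m f z) \<in> line_L1 \<gamma> \<and>
               f x = 1 / (2 * of_real pi * \<i>) *
                 line_integral \<gamma> (\<lambda>z. S_hat m z x * index_transform \<mu> m f z)))"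
proof -
  obtain \<phi> where \<phi>: "integrable lborel \<phi>" and AE: "AE t in lebesgue. fs (Complex c0 t) = \<phi> t"
    and f_log: "\<And>u. f (exp u) = log_mellin c0 \<phi> u" using f by (rule mellin_rep_log) blast
  have [measurable]: "\<phi> \<in> borel_measurable borel" using \<phi> by (simp add: borel_measurable_integrable)
  have transform: "set_integrable lebesgue {0<..} (\<lambda>x. meijer_G (\<mu> z) m z ((x / real m) ^ m) * f x)"
      "index_transform \<mu> m f z = gamma_transform c0 m \<phi> z" if "Re z > c0 - 1" for z
    using index_transform_eq_gamma_transform[of m c0 z \<mu> \<phi> f] m c0 that \<mu> \<phi> f_log by blast+
  show ?thesis
  proof (intro conjI allI impI)
    fix z and w :: real assume w: "w > 0"
    \<comment> \<open>Every positive argument of the \<open>G\<close>-function has the form \<open>(exp u / m) ^ m\<close>.\<close>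
    define u where "u = ln (real m) + ln w / real m"
    have "w = (exp u / real m) ^ m"
    proof -
      have "(exp u / real m) ^ m = exp (ln w / real m) ^ m" using m by (simp add: u_def exp_add)
      also have "\<dots> = exp (ln w)" using m by (simp add: exp_of_nat_mult[symmetric])
      finally show ?thesis using w by simp
    qed
    then show "meijer_integrand m z w \<in> line_L1 (\<mu> z)"
      using mellin_barnes_kernel(1)[OF m, of "\<mu> z" z u] \<mu>[of z]
      by (simp add: line_L1_def integrable_lborel_imp_lebesgue(1))
  next
    fix z assume "Re z > c0 - 1"
    then show "set_integrable lebesgue {0<..} (\<lambda>x. meijer_G (\<mu> z) m z ((x / real m) ^ m) * f x)" by (rule transform)
  next
    have "index_transform \<mu> m f holomorphic_on {z. Re z > c0 - 1}"
      using gamma_transform_holomorphic[OF m c0 \<phi>] by (rule holomorphic_transform) (use transform(2) in auto)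
    then show "index_transform \<mu> m f analytic_on {z. Re z > c0 - 1}"
      by (simp add: analytic_on_open open_halfspace_Re_gt)
  next
    fix z assume z: "Re z > c0 - 1"
    let ?k = "\<lambda>t. Gamma ((1 - Complex c0 t + z) / of_nat m) * Gamma (1 - Complex c0 t)"
    have k_bound: "norm (?k t) \<le> Gamma ((1 - c0 + Re z) / real m) * Gamma (1 - c0)" for t
      using norm_Gamma_le_Gamma_Re[of "(1 - Complex c0 t + z) / of_nat m"] norm_Gamma_le_Gamma_Re[of "1 - Complex c0 t"] c0 z m
      by (auto simp: norm_mult intro!: mult_mono)
    have "integrable lborel (\<lambda>t. ?k t * \<phi> t)"
    proof (rule Bochner_Integration.integrable_bound)
      show "integrable lborel (\<lambda>t. Gamma ((1 - c0 + Re z) / real m) * Gamma (1 - c0) * norm (\<phi> t))" using \<phi> by simp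
      show "AE t in lborel. norm (?k t * \<phi> t) \<le> norm (Gamma ((1 - c0 + Re z) / real m) * Gamma (1 - c0) * norm (\<phi> t))"
        using k_bound mult_right_mono[OF k_bound norm_ge_zero]
        by (intro AE_I2) (simp only: norm_mult[of _ "\<phi> _"] real_norm_def, rule order.trans[OF _ abs_ge_self])
    qed measurable
    note k_int = integrable_lborel_imp_lebesgue[OF this]
    have k_meas: "?k \<in> borel_measurable lebesgue" by (intro measurable_completion) measurable
    have fs_meas: "(\<lambda>t. fs (Complex c0 t)) \<in> borel_measurable lebesgue"
      using f by (auto simp: mellin_rep_def line_L1_def intro: borel_measurable_integrable)
    have AE': "AE t in lebesgue. ?k t * fs (Complex c0 t) = ?k t * \<phi> t" using AE by eventually_elim simp
    have meas': "(\<lambda>t. ?k t * fs (Complex c0 t)) \<in> borel_measurable lebesgue"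
      by (intro borel_measurable_times k_meas fs_meas)
    show "(\<lambda>s. Gamma ((1 - s + z) / of_nat m) * Gamma (1 - s) * fs s) \<in> line_L1 c0"
      unfolding line_L1_def mem_Collect_eq
      using integrable_cong_AE[OF meas' borel_measurable_integrable[OF k_int(1)] AE'] k_int(1) by simp
    have "(LINT t|lebesgue. ?k t * fs (Complex c0 t)) = (\<integral>t. ?k t * \<phi> t \<partial>lborel)"
      using integral_cong_AE[OF meas' borel_measurable_integrable[OF k_int(1)] AE'] k_int(2) by simp
    then show "index_transform \<mu> m f z = 1 / (2 * of_real pi * \<i> * of_nat m) *
              line_integral c0 (\<lambda>s. Gamma ((1 - s + z) / of_nat m) * Gamma (1 - s) * fs s)"
      unfolding transform(2)[OF z] gamma_transform_def line_integral_def by simp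
  next
    fix \<gamma> assume \<gamma>: "\<gamma> > c0 - 1"
    show "bounded_operator c0 \<gamma> (index_transform \<mu> m)"
      by (rule index_transform_bounded_operator[OF m c0 \<mu> \<gamma>])
    have "(LINT \<tau>|lebesgue. norm (Gamma (1 / of_nat m * Complex (1 - c0 + \<gamma>) \<tau>))) = gamma_line_mass (1 - c0 + \<gamma>) m"
      unfolding gamma_line_mass_def by (subst integral_completion) simp_all
    then show "operator_norm c0 \<gamma> (index_transform \<mu> m) \<le> Gamma (1 - c0) *
              (LINT \<tau>|lebesgue. norm (Gamma (1 / of_nat m * Complex (1 - c0 + \<gamma>) \<tau>)))"
      using index_transform_bounded_operator(2)[OF m c0 \<mu> \<gamma>] by simp
  next
    fix \<gamma> x :: real
    assume hyp: "c0 - 1 < \<gamma> \<and> \<gamma> < 0 \<and>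
        (\<lambda>z. index_transform \<mu> m f z / (\<Prod>k<m. Gamma ((of_nat k - z) / of_nat m))) \<in> line_L1 \<gamma>" and x: "x > 0"
    then have \<gamma>: "\<gamma> > c0 - 1" "\<gamma> < 0" by auto
    have eq: "index_transform \<mu> m f (Complex \<gamma> \<tau>) = gamma_transform c0 m \<phi> (Complex \<gamma> \<tau>)" for \<tau>
      using \<gamma> by (intro transform(2)) simp
    let ?T = "\<lambda>\<tau>. gamma_transform c0 m \<phi> (Complex \<gamma> \<tau>)"
    let ?P = "\<lambda>\<tau>. \<Prod>k<m. Gamma ((of_nat k - Complex \<gamma> \<tau>) / of_nat m)"
    \<comment> \<open>By Gauss' formula \<open>?P = ?C * \<Gamma>(- z)\<close>, and \<open>?C\<close> has constant modulus on the line.\<close>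
    let ?C = "\<lambda>\<tau>. of_real ((2 * pi) powr ((real m - 1) / 2) * sqrt (real m)) * exp (Complex \<gamma> \<tau> * of_real (ln (real m)))"
    have [measurable]: "?T \<in> borel_measurable borel"
      using gamma_transform_vertical_L1(1)[OF m c0 \<gamma>(1) \<phi>] by (simp add: borel_measurable_integrable)
    have TP: "integrable lborel (\<lambda>\<tau>. ?T \<tau> / ?P \<tau>)"
      using hyp by (intro integrable_lebesgue_imp_lborel) (simp_all add: line_L1_def eq)
    have "?T \<tau> / Gamma (- Complex \<gamma> \<tau>) = ?C \<tau> * (?T \<tau> / ?P \<tau>)" for \<tau>
      using prod_Gamma_quotient[OF m, of "Complex \<gamma> \<tau>"] \<gamma> m by simp
    moreover have "integrable lborel (\<lambda>\<tau>. ?C \<tau> * (?T \<tau> / ?P \<tau>))"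
    proof (rule Bochner_Integration.integrable_bound)
      show "integrable lborel (\<lambda>\<tau>. of_real ((2 * pi) powr ((real m - 1) / 2) * sqrt (real m) * exp (\<gamma> * ln (real m))) * (?T \<tau> / ?P \<tau>))"
        using TP by (rule integrable_mult_right)
    qed (auto simp: norm_mult norm_divide)
    ultimately have quot: "integrable lborel (\<lambda>\<tau>. ?T \<tau> / Gamma (- Complex \<gamma> \<tau>))" by simp
    note inv = log_mellin_inversion[OF m c0 \<gamma> \<phi> quot, of "ln x"]
    have exp_ln: "exp (ln x) = x" using x by simp
    show "(\<lambda>z. S_hat m z x * index_transform \<mu> m f z) \<in> line_L1 \<gamma>"
      unfolding line_L1_def mem_Collect_eq eq
      using integrable_lborel_imp_lebesgue(1)[OF inv(1)] unfolding exp_ln .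
    show "f x = 1 / (2 * of_real pi * \<i>) * line_integral \<gamma> (\<lambda>z. S_hat m z x * index_transform \<mu> m f z)"
      unfolding line_integral_def eq
      using f_log[of "ln x"] inv(2) integrable_lborel_imp_lebesgue(2)[OF inv(1)] unfolding exp_ln by simp
  qed
qed

end
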